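(* Let $M$ be a lattice of rank $n\ge1$ and let $p\in\mathbb{C}[M]$ be a Laurent polynomial with $\operatorname{supp}(p)$ unimodular. Let $\Sigma=\Sigma_{\operatorname{NP}(p)}$ be the normal fan of its Newton polytope, and write $$\operatorname{NP}(p)=\{x\in M_{\mathbb{R}}\mid\langle u_{\tau},x\rangle\ge-a_{\tau}\text{ for all }\tau\in\Sigma^{1}\}$$ with $a_{\tau}\in\mathbb{Z}$, where $-a_{\tau}=\min_{x\in \operatorname{NP}(p)}\langle u_\tau,x\rangle$. Then $$\operatorname{NP}(\mu(p))=\{x\in M_{\mathbb{R}}\mid\langle u_{\tau},x\rangle\ge-(n+1)a_{\tau}+1\text{ for all }\tau\in\Sigma^{1}\}.$$
   Context: $M_{\mathbb{R}}=M\otimes_{\mathbb{Z}}\mathbb{R}$, $N=M^{\vee}$ is the dual lattice, $N_{\mathbb{R}}=N\otimes_{\mathbb{Z}}\mathbb{R}$, and $\langle\cdot,\cdot\rangle$ is the pairing. $\mathbb{C}[M]$ is the group algebra, with monomials $\chi^{m}$, $m\in M$. For a nonzero $p=\sum_{j=0}^{s}c_{j}\chi^{m_{j}}$ ($c_{j}\ne0$, $m_{j}$ distinct), $\operatorname{supp}(p)=\{m_{0},\dots,m_{s}\}$ and $\operatorname{NP}(p)=\operatorname{conv}(\operatorname{supp}(p))\subset M_{\mathbb{R}}$. A finite subset $S\subset M$ is unimodular if for every vertex $v$ of $\operatorname{conv}(S)$ and every edge $E$ of $\operatorname{conv}(S)$ containing $v$ there exists $w_{E}\in E\cap S$ such that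 the vectors $w_{E}-v$ (over all such edges $E$) form a basis of $M$. For a face $F$ of $\operatorname{NP}(p)$, $\sigma_{F}=\{u\in N_{\mathbb{R}}\mid\langle u,x-y\rangle\ge0\text{ for all }x\in\operatorname{NP}(p),\,y\in F\}$. The normal fan is $\Sigma_{\operatorname{NP}(p)}=\{\sigma_{F}\mid F\text{ a face of }\operatorname{NP}(p)\}$; it is complete and unimodular when $\operatorname{supp}(p)$ is unimodular. $\Sigma^{1}$ is its set of rays and $u_{\tau}\in N$ is the smallest nonzero lattice vector in the ray $\tau$. The operator $\mu$: let $M_{p}=M\cap\sum_{j,k}\mathbb{R}(m_{j}-m_{k})$ and $r=\operatorname{rank}(M_{p})$. Choosing a basis of $M_{p}$ identifies $\mathbb{C}[M_{p}]$ with $\mathbb{C}[y_{1}^{\pm1},\dots,y_{r}^{\pm1}]$; with $D_{i}=y_{i}\,\partial/\partial y_{i}$ one sets, for $q\ne0$, $\delta_{M_{p}}(q)=\det(D_{i}D_{j}\log q)_{i,j=1}^{r}$, where $D_{i}D_{j}\log q=\big(q\,D_{i}D_{j}q-(D_{i}q)(D_{j}q)\big)/q^{2}$ (independent of the basis; the empty determinant is $1$). Then $\mu(p)=p^{r+1}\,\delta_{M_{p}}(\chi^{-m_{0}}p)$, a Laurent polynomial in $\mathbb{C}[M]$ independent of the choice of $m_{0}\in\operatorname{supp}(p)$. *)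

theory Defs
  imports
    "HOL-Analysis.Analysis"
    "HOL-Library.Poly_Mapping"
    "HOL-Computational_Algebra.Fraction_Field"
    "Jordan_Normal_Form.Determinant"
begin

no_notation Matrix.vec_index (infixl "$" 100)
no_notation Matrix.scalar_prod (infix "\<bullet>" 70)

text \<open>
  A lattice of rank \<open>n\<close> is given in coordinates as \<open>int ^ 'n\<close>, with \<open>n = CARD('n)\<close> (so \<open>n \<ge> 1\<close>).
  The dual lattice is again \<open>int ^ 'n\<close>, both real vector spaces are \<open>real ^ 'n\<close>, and the
  pairing is the inner product \<open>\<bullet>\<close>.
\<close>

definition real_vec :: "int ^ 'n \<Rightarrow> real ^ 'n" where
  "real_vec m = (\<chi> i. real_of_int (m $ i))"

interpretation int_vec: Modules.module "(*s) :: int \<Rightarrow> int ^ 'n \<Rightarrow> int ^ 'n::finite"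
  by unfold_locales (simp_all add: Finite_Cartesian_Product.vec_eq_iff algebra_simps)

definition lattice_basis :: "(int ^ 'n) set \<Rightarrow> (int ^ 'n::finite) set \<Rightarrow> bool" where
  "lattice_basis B L \<longleftrightarrow> int_vec.independent B \<and> int_vec.span B = L"

subsection \<open>The group algebra\<close>

text \<open>
  Finitely supported functions with convolution product. The copy of the type of \<open>Poly_Mapping\<close>
  is needed only for the \<open>idom\<close> instance: the library instance asks for a linear
  order on the exponents, whereas \<open>int ^ 'n\<close> carries the componentwise order.
\<close>

typedef ('n::finite) laurent = "UNIV :: ((int ^ 'n) \<Rightarrow>\<^sub>0 complex) set"
  morphisms laurent_map Laurent ..

setup_lifting type_definition_laurent

instantiation laurent :: (finite) comm_ring_1
begin

lift_definition zero_laurent :: "'a laurent" is 0 .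
lift_definition one_laurent :: "'a laurent" is 1 .
lift_definition plus_laurent :: "'a laurent \<Rightarrow> 'a laurent \<Rightarrow> 'a laurent" is "(+)" .
lift_definition minus_laurent :: "'a laurent \<Rightarrow> 'a laurent \<Rightarrow> 'a laurent" is "(-)" .
lift_definition uminus_laurent :: "'a laurent \<Rightarrow> 'a laurent" is uminus .
lift_definition times_laurent :: "'a laurent \<Rightarrow> 'a laurent \<Rightarrow> 'a laurent" is "(*)" .

instance
  by intro_classes (transfer; simp add: algebra_simps)+

end

lift_definition supp :: "'n::finite laurent \<Rightarrow> (int ^ 'n) set" is Poly_Mapping.keys .

lift_definition coefficient :: "'n::finite laurent \<Rightarrow> int ^ 'n \<Rightarrow> complex" is Poly_Mapping.lookup .

lift_definition laurent_monom :: "int ^ 'n \<Rightarrow> complex \<Rightarrow> 'n::finite laurent" is Poly_Mapping.single .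

lemma poly_mapping_no_zero_divisors:
  fixes f g :: "'a::ab_group_add \<Rightarrow>\<^sub>0 'c::idom" and h :: "'a \<Rightarrow> 'b::linordered_ab_group_add"
  assumes add: "\<And>x y. h (x + y) = h x + h y" and inj: "inj h" and "f \<noteq> 0" "g \<noteq> 0"
  shows "f * g \<noteq> 0"
proof -
  have max: "\<exists>a\<in>K. \<forall>x\<in>K. h x \<le> h a" if "finite K" "K \<noteq> {}" for K
  proof -
    have "Max (h ` K) \<in> h ` K" using that by (intro Max_in) auto
    moreover have "h x \<le> Max (h ` K)" if "x \<in> K" for x
      using that \<open>finite K\<close> by (intro Max_ge) auto
    ultimately show ?thesis by (metis imageE)
  qed
  have ne: "Poly_Mapping.keys f \<noteq> {}" "Poly_Mapping.keys g \<noteq> {}" using assms by auto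
  obtain a where a: "a \<in> Poly_Mapping.keys f" "\<And>x. x \<in> Poly_Mapping.keys f \<Longrightarrow> h x \<le> h a"
    using max[OF _ ne(1)] by auto
  obtain b where b: "b \<in> Poly_Mapping.keys g" "\<And>x. x \<in> Poly_Mapping.keys g \<Longrightarrow> h x \<le> h b"
    using max[OF _ ne(2)] by auto
  have uniq: "l = a \<and> q = b" if "l \<in> Poly_Mapping.keys f" "q \<in> Poly_Mapping.keys g" "a + b = l + q" for l q
  proof -
    have "h a + h b = h l + h q" by (metis add that(3))
    moreover have le: "h l \<le> h a" "h q \<le> h b" using a(2) b(2) that by auto
    ultimately have "h a + h b \<le> h l + h b" "h a + h b \<le> h a + h q"
      by (simp_all add: add_left_mono add_right_mono)
    with le have "h l = h a" "h q = h b" by (simp_all add: order.antisym)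
    then show ?thesis using inj by (auto dest: injD)
  qed
  have "Poly_Mapping.lookup (f * g) (a + b) = (\<Sum>(l, q). Poly_Mapping.lookup f l * Poly_Mapping.lookup g q when a + b = l + q)"
    by (simp add: times_poly_mapping.rep_eq prod_fun_unfold_prod)
  also have "\<dots> = (\<Sum>lq. (case lq of (l, q) \<Rightarrow> Poly_Mapping.lookup f l * Poly_Mapping.lookup g q) when (a, b) = lq)"
  proof (rule Sum_any.cong)
    fix lq :: "'a \<times> 'a"
    obtain l q where [simp]: "lq = (l, q)" by (cases lq)
    show "(case lq of (l, q) \<Rightarrow> (Poly_Mapping.lookup f l * Poly_Mapping.lookup g q when a + b = l + q)) =
        ((case lq of (l, q) \<Rightarrow> Poly_Mapping.lookup f l * Poly_Mapping.lookup g q) when (a, b) = lq)"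
      using uniq[of l q] by (auto simp: when_def in_keys_iff)
  qed
  also have "\<dots> = Poly_Mapping.lookup f a * Poly_Mapping.lookup g b" by simp
  also have "\<dots> \<noteq> 0" using a(1) b(1) by (simp add: in_keys_iff)
  finally show ?thesis by auto
qed

instance laurent :: (finite) idom
proof
  fix f g :: "'a laurent"
  assume nz: "f \<noteq> 0" "g \<noteq> 0"
  obtain e :: "'a \<Rightarrow> nat" where e: "inj e"
    using finite_imp_inj_to_nat_seg[of "UNIV :: 'a set"] by auto
  define h :: "int ^ 'a \<Rightarrow> nat \<Rightarrow>\<^sub>0 int"
    where "h m = (\<Sum>i\<in>UNIV. Poly_Mapping.single (e i) (m $ i))" for m
  have "Poly_Mapping.lookup (h m) (e j) = m $ j" for m j
    using e by (simp add: h_def lookup_sum lookup_single when_def inj_eq)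
  then have "x = y" if "h x = h y" for x y
    by (metis that Finite_Cartesian_Product.vec_eq_iff)
  then have "inj h" by (rule injI)
  moreover have "h (x + y) = h x + h y" for x y
    by (simp add: h_def single_add sum.distrib)
  moreover have "laurent_map f \<noteq> 0" "laurent_map g \<noteq> 0"
    using nz by (simp_all flip: laurent_map_inject zero_laurent.rep_eq)
  ultimately have "laurent_map f * laurent_map g \<noteq> 0"
    by (intro poly_mapping_no_zero_divisors[of h])
  then show "f * g \<noteq> 0"
    by (metis times_laurent.rep_eq zero_laurent.rep_eq)
qed

definition newton_polytope :: "'n::finite laurent \<Rightarrow> (real ^ 'n) set" where
  "newton_polytope p = convex hull (real_vec ` supp p)"

subsection \<open>Unimodularity\<close>

text \<open>
  The vertices of \<open>conv(S)\<close> lie in \<open>S\<close>, so it is enough to quantify over lattice points \<open>v\<close>.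
  Injectivity says that the basis is indexed by the edges at \<open>v\<close>.
\<close>

definition unimodular :: "(int ^ 'n::finite) set \<Rightarrow> bool" where
  "unimodular S \<longleftrightarrow> finite S \<and>
     (\<forall>v. real_vec v extreme_point_of (convex hull (real_vec ` S)) \<longrightarrow>
       (let \<E> = {E. E edge_of (convex hull (real_vec ` S)) \<and> real_vec v \<in> E} in
        \<exists>w. (\<forall>E\<in>\<E>. w E \<in> S \<and> real_vec (w E) \<in> E) \<and>
            inj_on (\<lambda>E. w E - v) \<E> \<and>
            lattice_basis ((\<lambda>E. w E - v) ` \<E>) UNIV))"

subsection \<open>The normal fan\<close>

definition normal_cone :: "(real ^ 'n::finite) set \<Rightarrow> (real ^ 'n) set \<Rightarrow> (real ^ 'n) set" where
  "normal_cone P F = {u. \<forall>x\<in>P. \<forall>y\<in>F. u \<bullet> (x - y) \<ge> 0}"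

text \<open>The relation \<open>face_of\<close> admits the empty face, which contributes no cone.\<close>

definition normal_fan :: "(real ^ 'n::finite) set \<Rightarrow> (real ^ 'n) set set" where
  "normal_fan P = {normal_cone P F | F. F face_of P \<and> F \<noteq> {}}"

definition fan_rays :: "(real ^ 'n::finite) set set \<Rightarrow> (real ^ 'n) set set" where
  "fan_rays \<Sigma> = {\<tau> \<in> \<Sigma>. dim \<tau> = 1}"

definition ray_generator :: "(real ^ 'n::finite) set \<Rightarrow> int ^ 'n" where
  "ray_generator \<tau> = (ARG_MIN (\<lambda>u. norm (real_vec u)) u. u \<noteq> 0 \<and> real_vec u \<in> \<tau>)"

text \<open>The number \<open>a\<^sub>\<tau>\<close>, where \<open>- a\<^sub>\<tau>\<close> is the minimum (\<open>LEAST\<close>) of \<open>u\<^sub>\<tau>\<close> on \<open>P\<close>.\<close>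

definition facet_constant :: "(real ^ 'n::finite) set \<Rightarrow> (real ^ 'n) set \<Rightarrow> real" where
  "facet_constant P \<tau> = - (LEAST t. t \<in> (\<lambda>x. real_vec (ray_generator \<tau>) \<bullet> x) ` P)"

subsection \<open>The operator \<open>\<mu>\<close>\<close>

definition difference_lattice :: "'n::finite laurent \<Rightarrow> (int ^ 'n) set" where
  "difference_lattice p =
     {m. real_vec m \<in> span {real_vec a - real_vec b | a b. a \<in> supp p \<and> b \<in> supp p}}"

definition chosen_basis :: "(int ^ 'n::finite) set \<Rightarrow> (int ^ 'n) list" where
  "chosen_basis L = (SOME bs. distinct bs \<and> lattice_basis (set bs) L)"

definition lattice_rank :: "(int ^ 'n::finite) set \<Rightarrow> nat" where
  "lattice_rank L = length (chosen_basis L)"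

text \<open>
  For a \<open>\<int>\<close>-basis \<open>B\<close> of \<open>L\<close> with coordinates \<open>y\<^sub>b\<close> (\<open>b \<in> B\<close>) on \<open>\<complex>[L]\<close>, the operator
  \<open>y\<^sub>b \<partial>/\<partial>y\<^sub>b\<close> multiplies a monomial by the \<open>b\<close>-coordinate of its exponent. It is meant for
  arguments with support in \<open>L\<close>.
\<close>

definition euler_op :: "(int ^ 'n::finite) set \<Rightarrow> int ^ 'n \<Rightarrow> 'n laurent \<Rightarrow> 'n laurent" where
  "euler_op B b q =
     (\<Sum>m\<in>supp q. laurent_monom m (of_int (int_vec.representation B m b) * coefficient q m))"

text \<open>\<open>D\<^sub>b D\<^sub>c log q\<close> in the fraction field\<close>

definition log_hessian ::
  "(int ^ 'n::finite) set \<Rightarrow> 'n laurent \<Rightarrow> int ^ 'n \<Rightarrow> int ^ 'n \<Rightarrow> 'n laurent fract" where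
  "log_hessian B q b c =
     Fract (q * euler_op B b (euler_op B c q) - euler_op B b q * euler_op B c q) (q ^ 2)"

definition delta :: "(int ^ 'n::finite) set \<Rightarrow> 'n laurent \<Rightarrow> 'n laurent fract" where
  "delta L q = (let bs = chosen_basis L in
     Determinant.det (Matrix.mat (length bs) (length bs)
       (\<lambda>(i, j). log_hessian (set bs) q (bs ! i) (bs ! j))))"

text \<open>
  \<open>\<mu>(p)\<close> is the Laurent polynomial whose image in the fraction field is
  \<open>p\<^bsup>r+1\<^esup> \<delta>(\<chi>\<^bsup>-m\<^sub>0\<^esup> p)\<close>; such a Laurent polynomial exists because \<open>p\<^bsup>r+1\<^esup>\<close> clears
  the denominator of the determinant (the Hessian of the logarithm is a rank-one perturbation of
  \<open>(D\<^sub>i D\<^sub>j q) / q\<close>).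
\<close>

definition mu :: "'n::finite laurent \<Rightarrow> 'n laurent" where
  "mu p = (let L = difference_lattice p; m\<^sub>0 = (SOME m. m \<in> supp p) in
     THE f. Fract f 1 =
       Fract (p ^ (lattice_rank L + 1)) 1 * delta L (laurent_monom (- m\<^sub>0) 1 * p))"

end

theory Submission
  imports Defs
begin

text \<open>
  Write \<open>S = supp p\<close>, \<open>P = NP(p)\<close> and \<open>n\<close> for the rank. A vertex \<open>v\<close> of \<open>P\<close> comes with the lattice
  basis \<open>B\<close> formed by the unimodular edge vectors at \<open>v\<close>, and with the dual basis
  \<open>u\<^sub>b\<close>, \<open>b \<in> B\<close>, of integral functionals. The proof has three ingredients.

  The first is that \<open>P\<close> lies in the cone at \<open>v\<close> spanned by its edges: a functional that is minimal at
  \<open>v\<close> along each edge is minimal at \<open>v\<close> on all of \<open>P\<close>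
  (\<open>minimal_at_vertex_if_minimal_along_edges\<close>). Hence every \<open>u\<^sub>b\<close> takes its minimum over \<open>P\<close> at \<open>v\<close>.
  The rays of the normal fan are the rays spanned by these \<open>u\<^sub>b\<close>, over all \<open>v\<close> and
  \<open>b\<close> (\<open>fan_rays_iff\<close>); such a functional is primitive, because \<open>\<langle>u\<^sub>b, b\<rangle> = 1\<close>. So the inequality
  attached to a ray reads \<open>\<langle>u\<^sub>b, x\<rangle> \<ge> \<langle>u\<^sub>b, v\<rangle>\<close>, and it becomes
  \<open>\<langle>u\<^sub>b, x\<rangle> \<ge> (n + 1) \<langle>u\<^sub>b, v\<rangle> + 1\<close> for \<open>\<mu>(p)\<close>.

  The second is completeness of the normal fan (\<open>in_convex_hull_of_vertex_points\<close>): choose a point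
  \<open>z\<^sub>v\<close> for each vertex; if \<open>\<langle>u\<^sub>b, x\<rangle> \<ge> \<langle>u\<^sub>b, z\<^sub>v\<rangle>\<close> for all \<open>v\<close> and \<open>b\<close>, then \<open>x\<close> is in the convex
  hull of the \<open>z\<^sub>v\<close>. Indeed, any functional \<open>a\<close> is minimal on \<open>P\<close> at some vertex \<open>v\<close>, so it is a
  nonnegative combination of the \<open>u\<^sub>b\<close> at that \<open>v\<close>; thus \<open>\<langle>a, x\<rangle> \<ge> \<langle>a, z\<^sub>v\<rangle>\<close>, and no hyperplane
  separates \<open>x\<close> from the \<open>z\<^sub>v\<close>. With \<open>z\<^sub>v = v\<close> this describes \<open>P\<close> by inequalities. With
  \<open>z\<^sub>v = (n + 1) v + \<Sum>B\<close>, for which the inequalities of \<open>\<mu>(p)\<close> at \<open>v\<close> are equalities, it reduces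
  one inclusion for \<open>\<mu>(p)\<close> to the claim that all these points lie in \<open>supp \<mu>(p)\<close>.

  The third is a Cauchy-Binet expansion of \<open>\<mu>(p)\<close>. Bordering the logarithmic Hessian turns \<open>\<mu>(p)\<close> into
  the determinant of the Gram-like matrix \<open>\<Sum>\<^sub>m c\<^sub>m \<chi>\<^sup>m (1,m) (1,m)\<^sup>T\<close>, so \<open>\<mu>(p)\<close> is a sum, over
  tuples of \<open>n + 1\<close> points of \<open>S\<close>, of monomials at the sum of the tuple, weighted by its affine
  determinant (\<open>mu_expansion\<close>). Affinely independent points do not all lie on the facet
  where \<open>u\<^sub>b\<close> is minimal, and the pairings are integers: this is the \<open>+ 1\<close>
  (\<open>supp_mu_pairing_ge\<close>). And the only affinely independent tuples of sum \<open>(n + 1) v + \<Sum>B\<close> are the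
  orderings of \<open>v\<close> and the points \<open>v + b\<close>; together they contribute the product of their
  coefficients times the square of a nonzero determinant (\<open>vertex_sum_in_supp_mu\<close>).
\<close>

section \<open>Functionals minimal at a vertex of a polytope\<close>

text \<open>
  A face through \<open>x\<close> with the fewest subfaces works: if \<open>x\<close> were on its relative boundary, then
  a proper face of it would contain \<open>x\<close> and have fewer subfaces.
\<close>

lemma exists_face_rel_interior:
  fixes P :: "'a::euclidean_space set"
  assumes P: "polytope P" and x: "x \<in> P"
  obtains F where "F face_of P" "x \<in> rel_interior F"
proof -
  obtain F where F: "F face_of P" "x \<in> F" and min: "\<And>G. G face_of P \<Longrightarrow> x \<in> G \<Longrightarrow> card {H. H face_of F} \<le> card {H. H face_of G}"
    using ex_has_least_nat[of "\<lambda>F. F face_of P \<and> x \<in> F" P "\<lambda>F. card {H. H face_of F}"]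
      face_of_refl[OF polytope_imp_convex[OF P]] x by blast
  have pF: "polytope F" using F P face_of_polytope_polytope by blast
  have "x \<in> rel_interior F"
  proof (rule ccontr)
    assume "x \<notin> rel_interior F"
    then have "x \<in> \<Union> {G. G face_of F \<and> G \<noteq> F}"
      using rel_frontier_of_polyhedron_alt[OF polytope_imp_polyhedron[OF pF]] F(2)
      unfolding rel_frontier_def using closure_subset by blast
    then obtain G where G: "G face_of F" "G \<noteq> F" "x \<in> G" by blast
    have "{H. H face_of G} \<subset> {H. H face_of F}"
      using G face_of_trans face_of_refl[OF polytope_imp_convex[OF pF]] face_of_imp_subset
      by (auto 0 3 dest: face_of_imp_subset intro: face_of_trans)
    then have "card {H. H face_of G} < card {H. H face_of F}"
      using finite_polytope_faces[OF pF] psubset_card_mono by blast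
    moreover have "G face_of P" using G F face_of_trans by blast
    ultimately show False using min[of G] G by fastforce
  qed
  then show ?thesis using F that by blast
qed

text \<open>
  If \<open>F\<close> had dimension at least \<open>2\<close>, then some direction \<open>d\<close> of \<open>F\<close> would be parallel to the
  hyperplane, and \<open>z\<close> could be moved both ways along \<open>d\<close> inside the slice.
\<close>

lemma aff_dim_le_1_of_extreme_section:
  fixes F :: "'a::euclidean_space set"
  assumes z: "z \<in> rel_interior F" and "z extreme_point_of (F \<inter> {x. h \<bullet> x = b})"
  shows "aff_dim F \<le> 1"
proof (rule ccontr)
  assume "\<not> aff_dim F \<le> 1"
  define V where "V = span ((\<lambda>x. x - z) ` F)"
  have zF: "z \<in> F" using z rel_interior_subset by blast
  have "int (dim V) = aff_dim F"
    using aff_dim_dim_affine_diffs[of "affine hull F" z]  zF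
    by (simp add: V_def aff_dim_eq_dim[of z F] hull_inc dim_span)
  then have "dim V \<ge> 2" using \<open>\<not> aff_dim F \<le> 1\<close> by linarith
  obtain d where d: "d \<in> V" "d \<noteq> 0" "h \<bullet> d = 0"
  proof -
    have *: "\<exists>w\<in>V. w \<notin> span {k}" for k
    proof (rule ccontr)
      assume "\<not> (\<exists>w\<in>V. w \<notin> span {k})"
      then have "V \<subseteq> span {k}" by blast
      then have "dim V \<le> dim {k}" using dim_subset dim_span by metis
      also have "\<dots> \<le> 1" using dim_le_card'[of "{k}"] by simp
      finally show False using \<open>dim V \<ge> 2\<close> by simp
    qed
    obtain k where k: "k \<in> V" "k \<noteq> 0" using *[of 0] span_0 by (metis span_zero)
    obtain w where w: "w \<in> V" "w \<notin> span {k}" using * by blast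
    show ?thesis
    proof (cases "h \<bullet> k = 0")
      case True
      then show ?thesis using that k by blast
    next
      case False
      define t where "t = (h \<bullet> w) / (h \<bullet> k)"
      have "w - t *\<^sub>R k \<in> V" using w k unfolding V_def by (intro span_diff span_scale)
      moreover have "w - t *\<^sub>R k \<noteq> 0"
        using w(2) by (metis eq_iff_diff_eq_0 span_base span_scale insertI1)
      moreover have "h \<bullet> (w - t *\<^sub>R k) = 0"
        using False by (simp add: t_def inner_diff_right)
      ultimately show ?thesis using that by blast
    qed
  qed
  obtain e where e: "e > 0" "ball z e \<inter> affine hull F \<subseteq> F"
    using z by (auto simp: mem_rel_interior_ball)
  have aff: "z + t *\<^sub>R d \<in> affine hull F" for t
  proof -
    have "t *\<^sub>R d \<in> V" using d unfolding V_def by (intro span_scale)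
    then have "t *\<^sub>R d \<in> span ((\<lambda>x. x - z) ` (F - {z}))"
      unfolding V_def by (metis (no_types, lifting) diff_self image_insert insert_Diff span_insert_0 zF)
    then show ?thesis using affine_hull_span2[OF zF] by (auto simp: algebra_simps)
  qed
  \<comment> \<open>Small enough for \<open>z \<plusminus> t d\<close> to stay in the ball around \<open>z\<close>.\<close>
  define t where "t = e / (2 * norm d)"
  have t: "t > 0" "t * norm d < e" using e d by (auto simp: t_def)
  have mem: "z + s *\<^sub>R d \<in> F \<inter> {x. h \<bullet> x = b}" if "\<bar>s\<bar> = t" for s
  proof -
    have "z + s *\<^sub>R d \<in> ball z e" using t that by (simp add: dist_norm)
    moreover have "h \<bullet> z = b" using assms(2) by (simp add: extreme_point_of_def)
    ultimately show ?thesis using aff e d by (auto simp: inner_add_right)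
  qed
  have "z \<in> open_segment (z + t *\<^sub>R d) (z + (- t) *\<^sub>R d)"
    unfolding in_segment using t d by (auto intro!: exI[of _ "1/2"] simp: algebra_simps simp flip: scaleR_add_left)
  then show False
    using assms(2) mem[of t] mem[of "-t"] t unfolding extreme_point_of_def by auto
qed

text \<open>
  This is why the simplex method stops at an optimum. A hyperplane \<open>H\<close> that separates \<open>v\<close> from the
  other vertices cuts out the vertex figure \<open>P \<inter> H\<close>, all of whose extreme points lie on
  edges at \<open>v\<close>; so \<open>u\<close> is at least \<open>u \<bullet> v\<close> on the vertex figure, and therefore at every other vertex
  \<open>x\<close>, because the segment from \<open>v\<close> to \<open>x\<close> crosses \<open>H\<close>.
\<close>

lemma minimal_at_vertex_if_minimal_along_edges:
  fixes P :: "'a::euclidean_space set"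
  assumes P: "polytope P" and v: "v extreme_point_of P"
    and edges: "\<And>E y. E edge_of P \<Longrightarrow> v \<in> E \<Longrightarrow> y \<in> E \<Longrightarrow> u \<bullet> v \<le> u \<bullet> y"
    and "x \<in> P"
  shows "u \<bullet> v \<le> u \<bullet> x"
proof -
  define K where "K = {x. x extreme_point_of P}"
  have finK: "finite K" unfolding K_def using finite_polyhedron_extreme_points[OF polytope_imp_polyhedron[OF P]] .
  have PK: "P = convex hull K"
    unfolding K_def using Krein_Milman_Minkowski[OF polytope_imp_compact[OF P] polytope_imp_convex[OF P]] .
  have vK: "v \<in> K" using v by (simp add: K_def)
  have "v \<notin> convex hull (K - {v})"
  proof
    assume "v \<in> convex hull (K - {v})"
    then have "v extreme_point_of (convex hull (K - {v}))"
      using v PK hull_mono[of "K - {v}" K convex] unfolding extreme_point_of_def by blast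
    then show False using extreme_point_of_convex_hull by blast
  qed
  moreover have "closed (convex hull (K - {v}))"
    using finK by (intro compact_imp_closed finite_imp_compact_convex_hull) auto
  ultimately obtain h b where h: "h \<bullet> v < b" "\<And>x. x \<in> convex hull (K - {v}) \<Longrightarrow> h \<bullet> x > b"
    using separating_hyperplane_closed_point[of "convex hull (K - {v})" v] by auto
  have hK: "h \<bullet> x > b" if "x \<in> K" "x \<noteq> v" for x
    using h(2)[of x] that hull_inc[of x "K - {v}"] by blast
  define H where "H = {x. h \<bullet> x = b}"
  have PH: "polytope (P \<inter> H)"
    unfolding H_def using P by (intro polytope_Int_polyhedron polyhedron_hyperplane)
  have on_slice: "u \<bullet> v \<le> u \<bullet> z" if z: "z extreme_point_of (P \<inter> H)" for z
  proof -
    have "z \<in> P" "z \<in> H" using z by (auto simp: extreme_point_of_def)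
    obtain F where F: "F face_of P" "z \<in> rel_interior F"
      using exists_face_rel_interior[OF P \<open>z \<in> P\<close>] .
    have zF: "z \<in> F" using F(2) rel_interior_subset by blast
    have pF: "polytope F" using F P face_of_polytope_polytope by blast
    have "z extreme_point_of (F \<inter> H)"
      using z zF face_of_imp_subset[OF F(1)] unfolding extreme_point_of_def by blast
    then have "aff_dim F \<le> 1" using aff_dim_le_1_of_extreme_section F(2) unfolding H_def by blast
    moreover have "aff_dim F \<noteq> 0"
    proof
      assume "aff_dim F = 0"
      then have "F = {z}" using zF aff_dim_eq_0 by (metis singletonD)
      then have "z \<in> K" using F(1) by (simp add: K_def face_of_singleton)
      then show False using hK[of z] h(1) \<open>z \<in> H\<close> by (cases "z = v") (auto simp: H_def)
    qed
    moreover have "aff_dim F \<ge> 0" using zF aff_dim_negative_iff[of F] by (metis empty_iff linorder_not_less)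
    ultimately have edge: "F edge_of P" using F(1) by (simp add: edge_of_def)
    have "v \<in> F"
    proof (rule ccontr)
      assume "v \<notin> F"
      have "F = convex hull {x. x extreme_point_of F}"
        using Krein_Milman_Minkowski[OF polytope_imp_compact[OF pF] polytope_imp_convex[OF pF]] .
      also have "\<dots> \<subseteq> convex hull (K - {v})"
        using \<open>v \<notin> F\<close> extreme_point_of_face[OF F(1)] unfolding K_def by (intro hull_mono) auto
      finally show False using h(2)[of z] zF \<open>z \<in> H\<close> by (auto simp: H_def)
    qed
    then show ?thesis using edges edge zF by blast
  qed
  have "P \<inter> H = convex hull {z. z extreme_point_of (P \<inter> H)}"
    using Krein_Milman_Minkowski[OF polytope_imp_compact[OF PH] polytope_imp_convex[OF PH]] .
  also have "\<dots> \<subseteq> {z. u \<bullet> v \<le> u \<bullet> z}"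
    using on_slice by (intro hull_minimal) (auto simp: convex_halfspace_ge)
  finally have onH: "u \<bullet> v \<le> u \<bullet> z" if "z \<in> P" "z \<in> H" for z using that by blast
  have "K \<subseteq> {z. u \<bullet> v \<le> u \<bullet> z}"
  proof clarify
    fix x assume x: "x \<in> K"
    show "u \<bullet> v \<le> u \<bullet> x"
    proof (cases "x = v")
      case False
      define t where "t = (b - h \<bullet> v) / (h \<bullet> x - h \<bullet> v)"
      have t: "0 < t" "t < 1" using hK[OF x False] h(1) by (auto simp: t_def)
      define z where "z = (1 - t) *\<^sub>R v + t *\<^sub>R x"
      have "h \<bullet> z = h \<bullet> v + t * (h \<bullet> x - h \<bullet> v)"
        by (simp add: z_def inner_add_right algebra_simps)
      also have "\<dots> = b" using hK[OF x False] h(1) by (simp add: t_def)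
      finally have "z \<in> H" by (simp add: H_def)
      moreover have "z \<in> P"
        using polytope_imp_convex[OF P] x vK t hull_inc[of _ K] unfolding z_def PK
        by (intro convexD) auto
      ultimately have "u \<bullet> v \<le> u \<bullet> z" using onH by blast
      then have "0 \<le> t * (u \<bullet> x - u \<bullet> v)" by (simp add: z_def inner_add_right algebra_simps)
      then show ?thesis using t by (simp add: zero_le_mult_iff)
    qed simp
  qed
  then have "P \<subseteq> {z. u \<bullet> v \<le> u \<bullet> z}"
    unfolding PK by (intro hull_minimal) (auto simp: convex_halfspace_ge)
  then show ?thesis using \<open>x \<in> P\<close> by blast
qed

section \<open>Lattice bases and dual bases\<close>

lemma real_vec_simps [simp]:
  "real_vec (x + y) = real_vec x + real_vec y"
  "real_vec (x - y) = real_vec x - real_vec y"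
  "real_vec (- x) = - real_vec x"
  "real_vec 0 = 0"
  "real_vec (c *s x) = real_of_int c *\<^sub>R real_vec x"
  by (simp_all add: real_vec_def Finite_Cartesian_Product.vec_eq_iff)

lemma real_vec_sum: "real_vec (sum f A) = (\<Sum>a\<in>A. real_vec (f a))"
  by (induction A rule: infinite_finite_induct) auto

lemma real_vec_eq_iff [simp]: "real_vec x = real_vec y \<longleftrightarrow> x = y"
  by (simp add: real_vec_def Finite_Cartesian_Product.vec_eq_iff)

lemma real_vec_eq_0_iff [simp]: "real_vec x = 0 \<longleftrightarrow> x = 0"
  using real_vec_eq_iff[of x 0] by simp

definition int_pairing :: "int ^ 'n \<Rightarrow> int ^ 'n::finite \<Rightarrow> int" where
  "int_pairing u m = (\<Sum>i\<in>UNIV. u $ i * m $ i)"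

lemma inner_real_vec: "real_vec u \<bullet> real_vec m = of_int (int_pairing u m)"
  by (simp add: inner_vec_def real_vec_def int_pairing_def)

lemma int_pairing_diff: "int_pairing u (x - y) = int_pairing u x - int_pairing u y"
  by (simp add: int_pairing_def algebra_simps sum_subtractf)

lemma int_pairing_add: "int_pairing u (x + y) = int_pairing u x + int_pairing u y"
  by (simp add: int_pairing_def algebra_simps sum.distrib)

lemma int_pairing_sum: "int_pairing u (sum f A) = (\<Sum>a\<in>A. int_pairing u (f a))"
  by (induction A rule: infinite_finite_induct) (auto simp: int_pairing_add, auto simp: int_pairing_def)

lemma int_pairing_scale: "int_pairing u (k *s x) = k * int_pairing u x"
  by (simp add: int_pairing_def sum_distrib_left mult_ac)

lemma int_pairing_diff_left: "int_pairing (u - w) x = int_pairing u x - int_pairing w x"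
  by (simp add: int_pairing_def algebra_simps sum_subtractf)

definition dual_vector :: "(int ^ 'n::finite) set \<Rightarrow> int ^ 'n \<Rightarrow> int ^ 'n" where
  "dual_vector B b = (\<chi> i. int_vec.representation B (axis i 1) b)"

locale lattice_with_basis =
  fixes B :: "(int ^ 'n::finite) set"
  assumes basis: "lattice_basis B UNIV"
begin

lemma independent: "int_vec.independent B" and span: "int_vec.span B = UNIV"
  using basis by (auto simp: lattice_basis_def)

lemma int_pairing_dual_vector: "int_pairing (dual_vector B b) m = int_vec.representation B m b"
proof -
  have "m = (\<Sum>i\<in>UNIV. (m $ i) *s axis i 1)"
    by (simp add: Finite_Cartesian_Product.vec_eq_iff axis_def if_distrib cong: if_cong)
  also have "int_vec.representation B \<dots> b = (\<Sum>i\<in>UNIV. m $ i * int_vec.representation B (axis i 1) b)"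
    by (simp add: int_vec.representation_sum int_vec.representation_scale independent span)
  finally show ?thesis by (simp add: int_pairing_def dual_vector_def mult.commute)
qed

lemma inner_dual_vector: "real_vec (dual_vector B b) \<bullet> real_vec m = of_int (int_vec.representation B m b)"
  by (simp add: inner_real_vec int_pairing_dual_vector)

lemma inner_dual_vector_basis:
  "b \<in> B \<Longrightarrow> c \<in> B \<Longrightarrow> real_vec (dual_vector B b) \<bullet> real_vec c = (if b = c then 1 else 0)"
  by (simp add: inner_dual_vector int_vec.representation_basis independent)

lemma real_independent: "independent (real_vec ` B)"
proof (rule ccontr)
  assume "\<not> independent (real_vec ` B)"
  then obtain b where b: "b \<in> B" "real_vec b \<in> span (real_vec ` B - {real_vec b})"
    unfolding dependent_def by blast
  have "real_vec ` B - {real_vec b} \<subseteq> {x. real_vec (dual_vector B b) \<bullet> x = 0}"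
    using inner_dual_vector_basis b by auto
  then have "span (real_vec ` B - {real_vec b}) \<subseteq> {x. real_vec (dual_vector B b) \<bullet> x = 0}"
    by (rule span_minimal) (rule subspace_hyperplane)
  then have "real_vec (dual_vector B b) \<bullet> real_vec b = 0" using b by blast
  then show False using inner_dual_vector_basis b by simp
qed

lemma inj_real_vec: "inj_on real_vec B"
  by (rule inj_onI) simp

lemma finite_basis: "finite B"
  using independent_imp_finite[OF real_independent] inj_real_vec finite_imageD by blast

lemma int_expansion: "(\<Sum>b\<in>B. int_vec.representation B m b *s b) = m"
  by (rule int_vec.sum_representation_eq) (use independent span finite_basis in auto)

lemma real_span: "Real_Vector_Spaces.span (real_vec ` B) = UNIV"
proof -
  have "axis i 1 = (\<Sum>b\<in>B. real_of_int (int_vec.representation B (axis i 1) b) *\<^sub>R real_vec b)" for i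
  proof -
    have "real_vec (axis i 1 :: int ^ 'n) = axis i 1"
      by (simp add: real_vec_def Finite_Cartesian_Product.vec_eq_iff axis_def)
    then show ?thesis
      using arg_cong[OF int_expansion[of "axis i 1"], of real_vec]
      by (simp add: real_vec_sum)
  qed
  then have "axis i 1 \<in> Real_Vector_Spaces.span (real_vec ` B)" for i
    by (smt (verit, best) imageI span_base span_scale span_sum)
  then have "Basis \<subseteq> Real_Vector_Spaces.span (real_vec ` B)"
    by (auto simp: Basis_vec_def)
  then show ?thesis using span_mono[of Basis "Real_Vector_Spaces.span (real_vec ` B)"]
    by (metis span_Basis span_span top.extremum_uniqueI)
qed

lemma card_basis: "card B = CARD('n)"
proof -
  have "card (real_vec ` B) = dim (UNIV :: (real ^ 'n) set)"
    using dim_eq_card_independent[OF real_independent] real_span dim_span by metis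
  then show ?thesis using card_image[OF inj_real_vec] by simp
qed

lemma coordinate_expansion: "(x :: real ^ 'n) = (\<Sum>b\<in>B. (real_vec (dual_vector B b) \<bullet> x) *\<^sub>R real_vec b)"
proof -
  let ?f = "\<lambda>x. \<Sum>b\<in>B. (real_vec (dual_vector B b) \<bullet> x) *\<^sub>R real_vec b"
  have "linear (\<lambda>x. x)" "linear ?f"
    by (auto intro!: linearI simp: inner_add_right scaleR_add_left sum.distrib scaleR_sum_right)
  then show ?thesis
  proof (rule linear_eq_on_span[where B = "real_vec ` B"])
    fix y assume "y \<in> real_vec ` B"
    then obtain c where c: "c \<in> B" "y = real_vec c" by blast
    have "?f y = (\<Sum>b\<in>B. if b = c then real_vec b else 0)"
      using c by (intro sum.cong) (auto simp: inner_dual_vector_basis)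
    then show "y = ?f y" using c finite_basis by simp
  next
    show "x \<in> Real_Vector_Spaces.span (real_vec ` B)" by (simp add: real_span)
  qed
qed

end

section \<open>The normal fan of a unimodular support\<close>

text \<open>
  The pairing with \<open>m\<close> shows that every nonzero lattice vector on the ray is a positive integral
  multiple of \<open>u\<close>, so \<open>u\<close> is the unique shortest one.
\<close>

lemma ray_generator_of_primitive:
  assumes "int_pairing u m = 1"
  shows "ray_generator {t *\<^sub>R real_vec u | t. t \<ge> 0} = u"
proof -
  have "u \<noteq> 0" using assms by (auto simp: int_pairing_def)
  have scale: "\<exists>k. x = k *s u \<and> k \<ge> 1" if x: "x \<noteq> 0" "real_vec x \<in> {t *\<^sub>R real_vec u | t. t \<ge> 0}" for x
  proof -
    obtain t where t: "t \<ge> 0" "real_vec x = t *\<^sub>R real_vec u"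
      using x(2) unfolding mem_Collect_eq by metis
    have "real_of_int (int_pairing x m) = t * real_of_int (int_pairing u m)"
      using arg_cong[OF t(2), of "\<lambda>y. y \<bullet> real_vec m"] by (simp add: inner_real_vec)
    then have k: "t = real_of_int (int_pairing x m)" using assms by simp
    then have "real_vec x = real_vec (int_pairing x m *s u)" using t by simp
    then have "x = int_pairing x m *s u" by (simp only: real_vec_eq_iff)
    moreover have "int_pairing x m \<noteq> 0" using calculation x(1) by auto
    then have "int_pairing x m \<ge> 1" using t(1) k by linarith
    ultimately show ?thesis by blast
  qed
  let ?Q = "\<lambda>x. x \<noteq> 0 \<and> real_vec x \<in> {t *\<^sub>R real_vec u | t. t \<ge> 0}"
  have "real_vec u \<in> {t *\<^sub>R real_vec u | t. t \<ge> 0}"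
    by (rule CollectI, rule exI[of _ 1]) simp
  then have Q: "?Q u" using \<open>u \<noteq> 0\<close> by blast
  have less: "norm (real_vec u) < norm (real_vec x)" if "?Q x" "x \<noteq> u" for x
  proof -
    obtain k where k: "x = k *s u" "k \<ge> 1" using scale \<open>?Q x\<close> by blast
    then have "k > 1" using \<open>x \<noteq> u\<close> by (cases "k = 1") auto
    then show ?thesis using \<open>u \<noteq> 0\<close> by (simp add: k(1))
  qed
  show ?thesis
    unfolding ray_generator_def arg_min_def
  proof (rule some_equality)
    have "\<not> norm (real_vec x) < norm (real_vec u)" if "?Q x" for x
      using less[OF that] by (cases "x = u") auto
    then show "is_arg_min (\<lambda>u. norm (real_vec u)) ?Q u"
      unfolding is_arg_min_def using Q by blast
  next
    fix x assume "is_arg_min (\<lambda>u. norm (real_vec u)) ?Q x"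
    then have "?Q x" "\<not> norm (real_vec u) < norm (real_vec x)"
      using Q unfolding is_arg_min_def by blast+
    then show "x = u" using less by blast
  qed
qed

lemma dim_ray:
  fixes u :: "'a::euclidean_space"
  assumes "u \<noteq> 0"
  shows "dim {t *\<^sub>R u | t. t \<ge> 0} = 1"
proof -
  have "u \<in> {t *\<^sub>R u | t. t \<ge> 0}" by (rule CollectI, rule exI[of _ 1]) simp
  then have "dim {u} \<le> dim {t *\<^sub>R u | t. t \<ge> 0}" by (intro dim_subset) auto
  moreover have "{t *\<^sub>R u | t. t \<ge> 0} \<subseteq> Real_Vector_Spaces.span {u}"
    by (auto simp: span_singleton)
  then have "dim {t *\<^sub>R u | t. t \<ge> 0} \<le> dim {u}"
    using dim_subset[of _ "Real_Vector_Spaces.span {u}"] by (simp only: dim_span)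
  ultimately show ?thesis using assms by (simp add: dim_singleton)
qed

text \<open>
  The vectors from a vertex to the neighbouring points of a unimodular support. The last clause says
  that \<open>conv(S)\<close> lies in the cone spanned by \<open>B\<close> at \<open>v\<close>, which is all that the normal fan and the
  expansion of \<open>\<mu>(p)\<close> need to know about the edges at \<open>v\<close>.
\<close>

definition edge_basis :: "(int ^ 'n::finite) set \<Rightarrow> int ^ 'n \<Rightarrow> (int ^ 'n) set \<Rightarrow> bool" where
  "edge_basis S v B \<longleftrightarrow> lattice_basis B UNIV \<and> (\<forall>b\<in>B. v + b \<in> S) \<and>
     (\<forall>b\<in>B. \<forall>x\<in>convex hull (real_vec ` S).
        real_vec (dual_vector B b) \<bullet> real_vec v \<le> real_vec (dual_vector B b) \<bullet> x)"

text \<open>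
  An edge lies on one side of each of its endpoints.
\<close>

lemma same_side_of_extreme_point:
  assumes E: "aff_dim E = 1" and v: "v extreme_point_of E" and w: "w \<in> E" "w \<noteq> v" and y: "y \<in> E"
  obtains t where "t \<ge> 0" "y - v = t *\<^sub>R (w - v)"
proof -
  have vE: "v \<in> E" using v by (simp add: extreme_point_of_def)
  have "collinear E" using E by (simp add: collinear_aff_dim)
  moreover have "{w, v, y} \<subseteq> E" using vE w y by blast
  ultimately have "collinear {w, v, y}" by (rule collinear_subset)
  then have "collinear {0, w - v, y - v}"
    using collinear_3[of w v y] by (simp add: NO_MATCH_def)
  then have "w - v = 0 \<or> y - v = 0 \<or> (\<exists>c. y - v = c *\<^sub>R (w - v))"
    by (simp only: collinear_lemma)
  then obtain t where t: "y - v = t *\<^sub>R (w - v)"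
    using w(2) by (metis right_minus_eq scaleR_zero_left)
  have "t \<ge> 0"
  proof (rule ccontr)
    assume "\<not> t \<ge> 0"
    \<comment> \<open>For \<open>t < 0\<close> the point \<open>v\<close> is the convex combination of \<open>w\<close> and \<open>y\<close> with weight \<open>s\<close> on \<open>y\<close>.\<close>
    define s where "s = 1 / (1 - t)"
    have s: "0 < s" "s < 1" "s * (1 - t) = 1" using \<open>\<not> t \<ge> 0\<close> by (auto simp: s_def)
    have y: "y = v + t *\<^sub>R (w - v)" using t by (simp add: algebra_simps)
    have "(1 - s) *\<^sub>R w + s *\<^sub>R y = w - (s * (1 - t)) *\<^sub>R (w - v)"
      unfolding y by (simp add: algebra_simps)
    then have "v = (1 - s) *\<^sub>R w + s *\<^sub>R y" using s by simp
    moreover have "w \<noteq> y"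
    proof
      assume "w = y"
      then have "(1 - t) *\<^sub>R (w - v) = 0" using y by (simp add: algebra_simps)
      then show False using \<open>\<not> t \<ge> 0\<close> w by simp
    qed
    ultimately have "v \<in> open_segment w y" using s unfolding in_segment by blast
    then show False using v w \<open>y \<in> E\<close> by (auto simp: extreme_point_of_def)
  qed
  then show ?thesis using t that by blast
qed

text \<open>
  A functional of the dual basis is \<open>0\<close> or \<open>1\<close> on each edge vector, so it is minimal at \<open>v\<close> along
  every edge at \<open>v\<close>, hence on the whole polytope.
\<close>

lemma edge_basis_exists:
  assumes S: "unimodular S" and v: "real_vec v extreme_point_of (convex hull (real_vec ` S))"
  shows "\<exists>B. edge_basis S v B"
proof -
  let ?P = "convex hull (real_vec ` S)"
  define \<E> where "\<E> = {E. E edge_of ?P \<and> real_vec v \<in> E}"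
  have finS: "finite S" using S by (simp add: unimodular_def)
  then have P: "polytope ?P" by (auto simp: polytope_def)
  obtain w where w: "\<And>E. E \<in> \<E> \<Longrightarrow> w E \<in> S \<and> real_vec (w E) \<in> E"
      "inj_on (\<lambda>E. w E - v) \<E>" "lattice_basis ((\<lambda>E. w E - v) ` \<E>) UNIV"
    using S v unfolding unimodular_def Let_def \<E>_def by blast
  define B where "B = (\<lambda>E. w E - v) ` \<E>"
  interpret lattice_with_basis B by unfold_locales (use w(3) B_def in simp)
  have "real_vec (dual_vector B b) \<bullet> real_vec v \<le> real_vec (dual_vector B b) \<bullet> x"
    if b: "b \<in> B" and x: "x \<in> ?P" for b x
  proof (rule minimal_at_vertex_if_minimal_along_edges[OF P v _ x])
    fix E y assume E: "E edge_of ?P" "real_vec v \<in> E" "y \<in> E"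
    then have "E \<in> \<E>" by (simp add: \<E>_def)
    then have wB: "w E - v \<in> B" by (simp add: B_def)
    then have "w E \<noteq> v" using independent int_vec.dependent_zero[of B] by auto
    have "real_vec v extreme_point_of E"
      using v E extreme_point_of_face[of E ?P] by (simp add: edge_of_def)
    then obtain t where t: "t \<ge> 0" "y - real_vec v = t *\<^sub>R (real_vec (w E) - real_vec v)"
      using same_side_of_extreme_point[of E "real_vec v" "real_vec (w E)" y] E w(1)[OF \<open>E \<in> \<E>\<close>] \<open>w E \<noteq> v\<close>
      by (auto simp: edge_of_def)
    have "real_vec (dual_vector B b) \<bullet> (y - real_vec v) = t * (real_vec (dual_vector B b) \<bullet> real_vec (w E - v))"
      using t(2) by simp
    also have "\<dots> \<ge> 0"
      unfolding inner_dual_vector_basis[OF b wB] using t(1) by simp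
    finally show "real_vec (dual_vector B b) \<bullet> real_vec v \<le> real_vec (dual_vector B b) \<bullet> y"
      by (simp add: inner_diff_right)
  qed
  moreover have "v + b \<in> S" if "b \<in> B" for b using that w(1) by (auto simp: B_def)
  moreover have "lattice_basis B UNIV" using basis .
  ultimately show ?thesis unfolding edge_basis_def by blast
qed

lemma vertex_in_support:
  "real_vec v extreme_point_of (convex hull (real_vec ` S)) \<Longrightarrow> v \<in> S"
  using extreme_point_of_convex_hull by fastforce

lemma minimum_at_vertex:
  assumes "finite S" "S \<noteq> {}"
  obtains v where "real_vec v extreme_point_of (convex hull (real_vec ` S))"
    "\<And>x. x \<in> convex hull (real_vec ` S) \<Longrightarrow> a \<bullet> real_vec v \<le> a \<bullet> x"
proof -
  let ?P = "convex hull (real_vec ` S)"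
  define K where "K = {v. real_vec v extreme_point_of ?P}"
  have "K \<subseteq> S" using vertex_in_support K_def by blast
  then have finK: "finite K" using assms finite_subset by blast
  have "{x. x extreme_point_of ?P} = real_vec ` K"
    using extreme_points_of_convex_hull[of "real_vec ` S"] by (auto simp: K_def)
  then have P: "?P = convex hull (real_vec ` K)"
    using Krein_Milman_Minkowski[of ?P] assms finite_imp_compact_convex_hull[of "real_vec ` S"] by auto
  have "K \<noteq> {}" using P assms by auto
  then have "Min ((\<lambda>x. a \<bullet> real_vec x) ` K) \<in> (\<lambda>x. a \<bullet> real_vec x) ` K"
    using finK by (intro Min_in) auto
  then obtain v where v: "v \<in> K" "Min ((\<lambda>x. a \<bullet> real_vec x) ` K) = a \<bullet> real_vec v" by blast
  have v2: "a \<bullet> real_vec v \<le> a \<bullet> real_vec x" if "x \<in> K" for x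
    unfolding v(2)[symmetric] using finK that by (intro Min_le) auto
  have "?P \<subseteq> {x. a \<bullet> real_vec v \<le> a \<bullet> x}"
    unfolding P using v2 by (intro hull_minimal) (auto simp: convex_halfspace_ge)
  then show ?thesis using that[of v] v(1) K_def by blast
qed

text \<open>
  Completeness of the normal fan, in the form in which it is used: a functional \<open>a\<close> separating
  \<open>x\<close> from all \<open>z v\<close> would be minimal on the polytope at some vertex \<open>v\<close>. Expanding
  \<open>x - z v\<close> in the basis \<open>B\<close> at \<open>v\<close>, both the coordinates and the values of \<open>a\<close> on \<open>B\<close> are nonnegative,
  so \<open>a \<bullet> x \<ge> a \<bullet> z v\<close>.
\<close>

lemma in_convex_hull_of_vertex_points:
  assumes "finite S" "S \<noteq> {}"
    and x: "\<And>v. real_vec v extreme_point_of (convex hull (real_vec ` S)) \<Longrightarrow>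
      \<exists>B. edge_basis S v B \<and> (\<forall>b\<in>B. real_vec (dual_vector B b) \<bullet> z v \<le> real_vec (dual_vector B b) \<bullet> x)"
  shows "x \<in> convex hull {z v | v. real_vec v extreme_point_of (convex hull (real_vec ` S))}"
proof (rule ccontr)
  let ?P = "convex hull (real_vec ` S)"
  let ?C = "convex hull {z v | v. real_vec v extreme_point_of ?P}"
  assume "x \<notin> ?C"
  have "{z v | v. real_vec v extreme_point_of ?P} \<subseteq> z ` S" using vertex_in_support by blast
  then have "finite {z v | v. real_vec v extreme_point_of ?P}" using assms finite_subset by blast
  then have "closed ?C" by (intro compact_imp_closed finite_imp_compact_convex_hull)
  then obtain a c where a: "a \<bullet> x < c" "\<And>y. y \<in> ?C \<Longrightarrow> a \<bullet> y > c"
    using separating_hyperplane_closed_point[of ?C x] \<open>x \<notin> ?C\<close> by auto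
  obtain v where v: "real_vec v extreme_point_of ?P" "\<And>y. y \<in> ?P \<Longrightarrow> a \<bullet> real_vec v \<le> a \<bullet> y"
    using minimum_at_vertex[OF assms(1,2)] by blast
  obtain B where B: "edge_basis S v B"
      "\<And>b. b \<in> B \<Longrightarrow> real_vec (dual_vector B b) \<bullet> z v \<le> real_vec (dual_vector B b) \<bullet> x"
    using x[OF v(1)] by blast
  interpret lattice_with_basis B by unfold_locales (use B(1) edge_basis_def in blast)
  have "a \<bullet> (x - z v) = (\<Sum>b\<in>B. (real_vec (dual_vector B b) \<bullet> (x - z v)) * (a \<bullet> real_vec b))"
    by (subst coordinate_expansion) (simp add: inner_sum_right)
  also have "\<dots> \<ge> 0"
  proof (intro sum_nonneg mult_nonneg_nonneg)
    fix b assume b: "b \<in> B"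
    show "0 \<le> real_vec (dual_vector B b) \<bullet> (x - z v)" using B(2)[OF b] by (simp add: inner_diff_right)
    have "v + b \<in> S" using B(1) b by (simp add: edge_basis_def)
    then have "real_vec (v + b) \<in> ?P" by (intro hull_inc imageI)
    then show "0 \<le> a \<bullet> real_vec b" using v(2)[of "real_vec (v + b)"] by (simp add: inner_add_right)
  qed
  finally have "a \<bullet> z v \<le> a \<bullet> x" by (simp add: inner_diff_right)
  moreover have "z v \<in> ?C" using v(1) by (intro hull_inc) blast
  ultimately show False using a by force
qed

lemma facet_constant_of_ray:
  assumes "ray_generator \<tau> = u" and "v \<in> P" and "\<And>x. x \<in> P \<Longrightarrow> real_vec u \<bullet> v \<le> real_vec u \<bullet> x"
  shows "facet_constant P \<tau> = - (real_vec u \<bullet> v)"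
  unfolding facet_constant_def assms(1)
  by (subst Least_equality[of _ "real_vec u \<bullet> v"]) (use assms in auto)

lemma ray_data_of_edge_basis:
  assumes B: "edge_basis S v B" and b: "b \<in> B" and v: "real_vec v \<in> convex hull (real_vec ` S)"
  defines "\<tau> \<equiv> {t *\<^sub>R real_vec (dual_vector B b) | t. t \<ge> 0}"
  shows "ray_generator \<tau> = dual_vector B b"
    and "facet_constant (convex hull (real_vec ` S)) \<tau> = - (real_vec (dual_vector B b) \<bullet> real_vec v)"
proof -
  interpret lattice_with_basis B by unfold_locales (use B edge_basis_def in blast)
  have "int_pairing (dual_vector B b) b = 1"
    using b by (simp add: int_pairing_dual_vector int_vec.representation_basis independent)
  then show *: "ray_generator \<tau> = dual_vector B b" unfolding \<tau>_def by (rule ray_generator_of_primitive)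
  show "facet_constant (convex hull (real_vec ` S)) \<tau> = - (real_vec (dual_vector B b) \<bullet> real_vec v)"
    using * v B b by (intro facet_constant_of_ray) (auto simp: edge_basis_def)
qed

text \<open>
  The facet of the polytope where \<open>dual_vector B b\<close> is minimal contains \<open>v\<close> and the points \<open>v + c\<close> for
  \<open>c \<noteq> b\<close>, which confines its normal cone to the line of \<open>dual_vector B b\<close>; the point \<open>v + b\<close> of the
  polytope fixes the sign. Conversely, let
  the normal cone of \<open>F\<close> be a ray, choose a vertex \<open>v\<close> of \<open>F\<close>, and let \<open>y \<noteq> 0\<close> be in the cone. Then \<open>y\<close> is
  a nonnegative combination of the dual basis at \<open>v\<close>, and since \<open>y\<close> is constant on \<open>F\<close>, so is
  each dual vector that occurs in it with positive coefficient. Such a dual vector lies in the ray and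
  spans it.
\<close>

lemma fan_rays_iff:
  assumes S: "unimodular S"
  shows "\<tau> \<in> fan_rays (normal_fan (convex hull (real_vec ` S))) \<longleftrightarrow>
    (\<exists>v B b. real_vec v extreme_point_of (convex hull (real_vec ` S)) \<and> edge_basis S v B \<and> b \<in> B \<and>
       \<tau> = {t *\<^sub>R real_vec (dual_vector B b) | t. t \<ge> 0})" (is "?L \<longleftrightarrow> ?R")
proof
  let ?P = "convex hull (real_vec ` S)"
  assume ?R
  then obtain v B b where v: "real_vec v extreme_point_of ?P" and B: "edge_basis S v B" and b: "b \<in> B"
    and \<tau>: "\<tau> = {t *\<^sub>R real_vec (dual_vector B b) | t. t \<ge> 0}" by blast
  interpret lattice_with_basis B by unfold_locales (use B edge_basis_def in blast)
  define u where "u = real_vec (dual_vector B b)"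
  define F where "F = ?P \<inter> {x. u \<bullet> x = u \<bullet> real_vec v}"
  have vP: "real_vec v \<in> ?P" using v by (simp add: extreme_point_of_def)
  have min: "u \<bullet> real_vec v \<le> u \<bullet> x" if "x \<in> ?P" for x
    using B b that by (auto simp: edge_basis_def u_def)
  have F: "F face_of ?P"
    unfolding F_def using min by (intro face_of_Int_supporting_hyperplane_ge) auto
  have vF: "real_vec v \<in> F" using vP by (simp add: F_def)
  have "u \<bullet> real_vec b = 1" unfolding u_def using b by (simp add: inner_dual_vector_basis)
  then have "u \<noteq> 0" by auto
  have "normal_cone ?P F = \<tau>"
  proof (intro equalityI subsetI)
    fix y assume y: "y \<in> normal_cone ?P F"
    have "(y - (y \<bullet> real_vec b) *\<^sub>R u) \<bullet> real_vec c = 0" if c: "c \<in> B" for c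
    proof (cases "c = b")
      case True
      then show ?thesis using \<open>u \<bullet> real_vec b = 1\<close> by (simp add: inner_diff_left)
    next
      case False
      have "v + c \<in> S" using B c by (simp add: edge_basis_def)
      then have cP: "real_vec (v + c) \<in> ?P" by (intro hull_inc imageI)
      have uc: "u \<bullet> real_vec c = 0" unfolding u_def using b c False by (simp add: inner_dual_vector_basis)
      then have cF: "real_vec (v + c) \<in> F" using cP by (simp add: F_def inner_add_right)
      have "y \<bullet> (real_vec (v + c) - real_vec v) \<ge> 0" "y \<bullet> (real_vec v - real_vec (v + c)) \<ge> 0"
        using y cP vP cF vF unfolding normal_cone_def by blast+
      then show ?thesis using uc by (simp add: inner_diff_left)
    qed
    then have "(y - (y \<bullet> real_vec b) *\<^sub>R u) \<bullet> x = 0" for x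
      by (subst coordinate_expansion[of x]) (simp add: inner_sum_right)
    then have "y - (y \<bullet> real_vec b) *\<^sub>R u = 0" using inner_eq_zero_iff by blast
    moreover have "y \<bullet> real_vec b \<ge> 0"
    proof -
      have "v + b \<in> S" using B b by (simp add: edge_basis_def)
      then have "real_vec (v + b) \<in> ?P" by (intro hull_inc imageI)
      then have "y \<bullet> (real_vec (v + b) - real_vec v) \<ge> 0" using y vF unfolding normal_cone_def by blast
      then show ?thesis by simp
    qed
    ultimately show "y \<in> \<tau>" unfolding \<tau> u_def by auto
  next
    fix y assume "y \<in> \<tau>"
    then obtain t where t: "t \<ge> 0" "y = t *\<^sub>R u" unfolding \<tau> u_def by auto
    then show "y \<in> normal_cone ?P F"
      using min by (auto simp: normal_cone_def F_def inner_diff_right intro!: mult_left_mono)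
  qed
  then have "\<tau> \<in> normal_fan ?P" using F vF unfolding normal_fan_def by blast
  moreover have "dim \<tau> = 1" unfolding \<tau> by (rule dim_ray) (use \<open>u \<noteq> 0\<close> u_def in simp)
  ultimately show ?L by (simp add: fan_rays_def)
next
  let ?P = "convex hull (real_vec ` S)"
  assume ?L
  then obtain F where F: "F face_of ?P" "F \<noteq> {}" and \<tau>: "\<tau> = normal_cone ?P F" and dim: "dim \<tau> = 1"
    by (auto simp: fan_rays_def normal_fan_def)
  have finS: "finite S" using S by (simp add: unimodular_def)
  then have "polytope ?P" by (auto simp: polytope_def)
  then have "polytope F" using F(1) face_of_polytope_polytope by blast
  then obtain z where z: "z extreme_point_of F"
    using F(2) Krein_Milman_Minkowski[OF polytope_imp_compact polytope_imp_convex, of F] by fastforce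
  then have "z extreme_point_of ?P" using extreme_point_of_face[OF F(1)] by blast
  then obtain v where v: "real_vec v extreme_point_of ?P" and zv: "z = real_vec v"
    using extreme_point_of_convex_hull by blast
  have vF: "real_vec v \<in> F" using z zv by (simp add: extreme_point_of_def)
  then have vP: "real_vec v \<in> ?P" using F(1) face_of_imp_subset by blast
  obtain B where B: "edge_basis S v B" using edge_basis_exists[OF S v] by blast
  interpret lattice_with_basis B by unfold_locales (use B edge_basis_def in blast)
  define u where "u b = real_vec (dual_vector B b)" for b
  have bP: "real_vec v + real_vec b \<in> ?P" if "b \<in> B" for b
  proof -
    have "v + b \<in> S" using B that by (simp add: edge_basis_def)
    then have "real_vec (v + b) \<in> ?P" by (intro hull_inc imageI)
    then show ?thesis by simp
  qed
  have "\<not> \<tau> \<subseteq> {0}" using dim by (metis dim_eq_0 zero_neq_one)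
  then obtain y where y: "y \<in> \<tau>" "y \<noteq> 0" by blast
  have y_nonneg: "y \<bullet> real_vec c \<ge> 0" if "c \<in> B" for c
  proof -
    have "y \<bullet> ((real_vec v + real_vec c) - real_vec v) \<ge> 0"
      using y(1) vF bP[OF that] unfolding \<tau> normal_cone_def by blast
    then show ?thesis by simp
  qed
  obtain b where b: "b \<in> B" "y \<bullet> real_vec b > 0"
  proof -
    have "\<exists>b\<in>B. y \<bullet> real_vec b \<noteq> 0"
    proof (rule ccontr)
      assume *: "\<not> (\<exists>b\<in>B. y \<bullet> real_vec b \<noteq> 0)"
      have "y \<bullet> y = (\<Sum>b\<in>B. (u b \<bullet> y) * (y \<bullet> real_vec b))"
        by (subst (2) coordinate_expansion[of y]) (simp add: inner_sum_right u_def)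
      also have "\<dots> = 0" using * by (intro sum.neutral) auto
      finally show False using y by simp
    qed
    then show ?thesis using y_nonneg that by (metis less_eq_real_def)
  qed
  have u_const: "u b \<bullet> x = u b \<bullet> real_vec v" if x: "x \<in> F" for x
  proof -
    have xP: "x \<in> ?P" using x F(1) face_of_imp_subset by blast
    have nonneg: "u c \<bullet> (x - real_vec v) \<ge> 0" if "c \<in> B" for c
      using B that xP by (auto simp: edge_basis_def u_def inner_diff_right)
    have "y \<bullet> (real_vec v - x) \<ge> 0" using y(1) x vP unfolding \<tau> normal_cone_def by blast
    then have "y \<bullet> (x - real_vec v) \<le> 0" by (simp add: inner_diff_right)
    moreover have "y \<bullet> (x - real_vec v) = (\<Sum>c\<in>B. (u c \<bullet> (x - real_vec v)) * (y \<bullet> real_vec c))"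
      by (subst coordinate_expansion[of "x - real_vec v"]) (simp add: inner_sum_right u_def)
    moreover have nn: "(u c \<bullet> (x - real_vec v)) * (y \<bullet> real_vec c) \<ge> 0" if "c \<in> B" for c
      using nonneg y_nonneg that by simp
    moreover have "(\<Sum>c\<in>B. (u c \<bullet> (x - real_vec v)) * (y \<bullet> real_vec c)) \<ge> 0"
      by (intro sum_nonneg nn)
    ultimately have "(\<Sum>c\<in>B. (u c \<bullet> (x - real_vec v)) * (y \<bullet> real_vec c)) = 0"
      by linarith
    then have "\<forall>c\<in>B. (u c \<bullet> (x - real_vec v)) * (y \<bullet> real_vec c) = 0"
      by (subst (asm) sum_nonneg_eq_0_iff[OF finite_basis]) (use nn in auto)
    then show ?thesis using b by (auto simp: inner_diff_right)
  qed
  have ub: "u b \<in> \<tau>"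
    unfolding \<tau> normal_cone_def using B b(1) u_const
    by (auto simp: inner_diff_right edge_basis_def u_def)
  have ubb: "u b \<bullet> real_vec b = 1" unfolding u_def using b by (simp add: inner_dual_vector_basis)
  then have "u b \<noteq> 0" by auto
  have "\<tau> = {t *\<^sub>R u b | t. t \<ge> 0}"
  proof (intro equalityI subsetI)
    fix w assume w: "w \<in> \<tau>"
    have "Real_Vector_Spaces.span {u b} = Real_Vector_Spaces.span \<tau>"
      using ub \<open>u b \<noteq> 0\<close> dim by (intro dim_eq_span) (auto simp: dim_singleton)
    then have "w \<in> Real_Vector_Spaces.span {u b}" using w span_base by blast
    then obtain t where t: "w = t *\<^sub>R u b" by (auto simp: span_singleton)
    have "w \<bullet> ((real_vec v + real_vec b) - real_vec v) \<ge> 0"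
      using w vF bP[OF b(1)] unfolding \<tau> normal_cone_def by blast
    then have "t \<ge> 0" using ubb by (simp add: t)
    then show "w \<in> {t *\<^sub>R u b | t. t \<ge> 0}" using t by blast
  next
    fix w assume "w \<in> {t *\<^sub>R u b | t. t \<ge> 0}"
    then obtain t where "t \<ge> 0" "w = t *\<^sub>R u b" by blast
    then show "w \<in> \<tau>" using ub unfolding \<tau> normal_cone_def by auto
  qed
  then show ?R using v B b(1) unfolding u_def by blast
qed

section \<open>Cauchy-Binet expansion of the logarithmic Hessian\<close>

lemma laurent_eqI: "(\<And>k. coefficient f k = coefficient g k) \<Longrightarrow> f = g"
  by transfer (rule poly_mapping_eqI)

lemma coefficient_simps [simp]:
  "coefficient 0 k = 0"
  "coefficient (f + g) k = coefficient f k + coefficient g k"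
  "coefficient (laurent_monom m c) k = (if k = m then c else 0)"
  by (transfer, simp add: lookup_add lookup_single when_def)+

lemma coefficient_sum: "coefficient (sum f A) k = (\<Sum>a\<in>A. coefficient (f a) k)"
  by (induction A rule: infinite_finite_induct) auto

lemma supp_conv_coefficient: "supp f = {k. coefficient f k \<noteq> 0}"
  by transfer (auto simp: in_keys_iff)

lemma finite_supp [simp]: "finite (supp f)"
  by transfer simp

lemma supp_eq_empty_iff [simp]: "supp f = {} \<longleftrightarrow> f = 0"
  by transfer simp

lemma laurent_expansion: "f = (\<Sum>m\<in>supp f. laurent_monom m (coefficient f m))"
  by (rule laurent_eqI) (auto simp: coefficient_sum supp_conv_coefficient finite_supp[unfolded supp_conv_coefficient])

lemma laurent_monom_mult: "laurent_monom a c * laurent_monom b d = laurent_monom (a + b) (c * d)"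
  by transfer (rule mult_single)

lemma laurent_monom_0_1: "laurent_monom 0 1 = 1"
  by transfer simp

lemma laurent_monom_add: "laurent_monom a (c + d) = laurent_monom a c + laurent_monom a d"
  by transfer (rule single_add)

lemma laurent_monom_uminus: "laurent_monom a (- c) = - laurent_monom a c"
  by transfer (rule single_uminus)

lemma laurent_monom_zero [simp]: "laurent_monom a 0 = 0"
  by transfer simp

lemma laurent_monom_sum: "laurent_monom a (sum f A) = (\<Sum>x\<in>A. laurent_monom a (f x))"
  by (induction A rule: infinite_finite_induct) (auto simp: laurent_monom_add)

lemma prod_laurent_monom:
  "(\<Prod>x\<in>A. laurent_monom (m x) (c x)) = laurent_monom (\<Sum>x\<in>A. m x) (\<Prod>x\<in>A. c x)"
  by (induction A rule: infinite_finite_induct) (auto simp: laurent_monom_mult laurent_monom_0_1)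

lemma coefficient_monom_mult: "coefficient (laurent_monom a c * f) k = c * coefficient f (k - a)"
proof -
  have "laurent_monom a c * f = (\<Sum>m\<in>supp f. laurent_monom (a + m) (c * coefficient f m))"
    by (subst laurent_expansion[of f]) (simp add: sum_distrib_left laurent_monom_mult)
  also have "coefficient \<dots> k = (\<Sum>m\<in>supp f. if m = k - a then c * coefficient f m else 0)"
    unfolding coefficient_sum by (intro sum.cong) (auto simp: algebra_simps)
  also have "\<dots> = c * coefficient f (k - a)"
    by (auto simp: supp_conv_coefficient finite_supp[unfolded supp_conv_coefficient])
  finally show ?thesis .
qed

lemma coefficient_euler_op:
  "coefficient (euler_op B b q) m = of_int (int_vec.representation B m b) * coefficient q m"
  unfolding euler_op_def coefficient_sum
  by (auto simp: supp_conv_coefficient finite_supp[unfolded supp_conv_coefficient])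

text \<open>
  Eliminating the first column below the corner \<open>Q\<close> leaves the Schur complement
  \<open>H - v v\<^sup>T / Q\<close>. When \<open>Q\<close>, \<open>v\<close> and \<open>H\<close> are a Laurent polynomial \<open>q\<close> and its first and second
  derivatives, this is \<open>q\<close> times the Hessian of \<open>log q\<close>.
\<close>

lemma det_bordered:
  fixes r :: nat and Q :: "'a::field" and v :: "nat \<Rightarrow> 'a" and H :: "nat \<Rightarrow> nat \<Rightarrow> 'a"
  assumes "Q \<noteq> 0"
  defines "A \<equiv> Matrix.mat (Suc r) (Suc r) (\<lambda>(i, j). case i of
      0 \<Rightarrow> (case j of 0 \<Rightarrow> Q | Suc j' \<Rightarrow> v j')
    | Suc i' \<Rightarrow> (case j of 0 \<Rightarrow> v i' | Suc j' \<Rightarrow> H i' j'))"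
  shows "Determinant.det A =
    Q ^ Suc r * Determinant.det (Matrix.mat r r (\<lambda>(i, j). (Q * H i j - v i * v j) / Q ^ 2))"
proof -
  define Qm where "Qm = Matrix.mat 1 1 (\<lambda>_. Q)"
  define vr where "vr = Matrix.mat 1 r (\<lambda>(i, j). v j)"
  define vc where "vc = Matrix.mat r 1 (\<lambda>(i, j). v i)"
  define Hm where "Hm = Matrix.mat r r (\<lambda>(i, j). H i j)"
  define lc where "lc = Matrix.mat r 1 (\<lambda>(i, j). - v i / Q)"
  \<comment> \<open>The unipotent matrix of the row operations.\<close>
  define L where "L = four_block_mat (1\<^sub>m 1) (0\<^sub>m 1 r) lc (1\<^sub>m r)"
  define C where "C = Matrix.mat r r (\<lambda>(i, j). (Q * H i j - v i * v j) / Q ^ 2)"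
  have carr: "Qm \<in> carrier_mat 1 1" "vr \<in> carrier_mat 1 r" "vc \<in> carrier_mat r 1"
    "Hm \<in> carrier_mat r r" "lc \<in> carrier_mat r 1" "C \<in> carrier_mat r r"
    by (auto simp: Qm_def vr_def vc_def Hm_def lc_def C_def)
  have A: "A = four_block_mat Qm vr vc Hm"
    by (rule eq_matI) (auto simp: A_def Qm_def vr_def vc_def Hm_def four_block_mat_def Let_def split: nat.splits)
  have "L * A = four_block_mat (1\<^sub>m 1 * Qm + 0\<^sub>m 1 r * vc) (1\<^sub>m 1 * vr + 0\<^sub>m 1 r * Hm)
      (lc * Qm + 1\<^sub>m r * vc) (lc * vr + 1\<^sub>m r * Hm)"
    unfolding L_def A by (rule mult_four_block_mat) (use carr in auto)
  also have "1\<^sub>m 1 * Qm + 0\<^sub>m 1 r * vc = Qm" using carr by auto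
  also have "1\<^sub>m 1 * vr + 0\<^sub>m 1 r * Hm = vr" using carr by auto
  also have "lc * Qm + 1\<^sub>m r * vc = 0\<^sub>m r 1"
    by (rule eq_matI)
      (use carr assms in \<open>auto simp: lc_def Qm_def vc_def scalar_prod_def\<close>)
  also have "lc * vr + 1\<^sub>m r * Hm = Q \<cdot>\<^sub>m C"
    by (rule eq_matI)
      (use carr assms in \<open>auto simp: lc_def Hm_def vr_def C_def scalar_prod_def field_simps power2_eq_square\<close>)
  finally have LA: "L * A = four_block_mat Qm vr (0\<^sub>m r 1) (Q \<cdot>\<^sub>m C)" .
  have "Determinant.det L = Determinant.det (1\<^sub>m 1 :: 'a mat) * Determinant.det (1\<^sub>m r :: 'a mat)"
    unfolding L_def by (rule det_four_block_mat_upper_right_zero) (use carr in auto)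
  then have "Determinant.det L = 1" by simp
  moreover have "L \<in> carrier_mat (1 + r) (1 + r)"
    unfolding L_def by (rule four_block_carrier_mat) auto
  then have "L \<in> carrier_mat (Suc r) (Suc r)" by simp
  then have "Determinant.det (L * A) = Determinant.det L * Determinant.det A"
    by (rule det_mult) (simp add: A_def)
  ultimately have "Determinant.det A = Determinant.det (four_block_mat Qm vr (0\<^sub>m r 1) (Q \<cdot>\<^sub>m C))"
    using LA by simp
  also have "\<dots> = Determinant.det Qm * Determinant.det (Q \<cdot>\<^sub>m C)"
    by (rule det_four_block_mat_lower_left_zero) (use carr in auto)
  also have "Determinant.det Qm = Q"
    using det_single[OF carr(1)] by (simp add: Qm_def)
  also have "Determinant.det (Q \<cdot>\<^sub>m C) = Q ^ r * Determinant.det C"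
    using carr by simp
  finally show ?thesis by (simp add: C_def)
qed

text \<open>
  Multilinearity in the rows: choosing one summand \<open>m = g i\<close> in every row \<open>i\<close> leaves a matrix whose
  rows are multiples of the vectors \<open>y (g i)\<close>. This is the Cauchy-Binet formula before tuples that differ
  by a permutation are collected.
\<close>

lemma det_sum_of_monomials:
  fixes x y :: "int ^ 'n::finite \<Rightarrow> nat \<Rightarrow> complex"
  assumes "finite S"
  shows "Determinant.det (Matrix.mat N N (\<lambda>(i, j). \<Sum>m\<in>S. laurent_monom m (x m i * y m j))) =
    (\<Sum>g\<in>PiE {0..<N} (\<lambda>_. S). laurent_monom (\<Sum>i\<in>{0..<N}. g i)
       ((\<Prod>i\<in>{0..<N}. x (g i) i) * Determinant.det (Matrix.mat N N (\<lambda>(i, j). y (g i) j))))"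
proof -
  let ?A = "Matrix.mat N N (\<lambda>(i, j). \<Sum>m\<in>S. laurent_monom m (x m i * y m j))"
  let ?G = "PiE {0..<N} (\<lambda>_. S)"
  let ?P = "{\<pi>. \<pi> permutes {0..<N}}"
  have lt: "\<pi> i < N" if "\<pi> permutes {0..<N}" "i < N" for \<pi> i
    using permutes_in_image[OF that(1), of i] that(2) by simp
  have sg: "signof \<pi> * laurent_monom m c = laurent_monom m (signof \<pi> * c)" for \<pi> m c
    by (auto simp: sign_def laurent_monom_uminus)
  have "Determinant.det ?A = (\<Sum>\<pi>\<in>?P. signof \<pi> * (\<Prod>i\<in>{0..<N}. ?A $$ (i, \<pi> i)))"
    by (rule det_def') simp
  also have "\<dots> = (\<Sum>\<pi>\<in>?P. signof \<pi> *
      (\<Sum>g\<in>?G. laurent_monom (\<Sum>i\<in>{0..<N}. g i) (\<Prod>i\<in>{0..<N}. x (g i) i * y (g i) (\<pi> i))))"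
  proof (rule sum.cong[OF refl])
    fix \<pi> assume "\<pi> \<in> ?P"
    then have "(\<Prod>i\<in>{0..<N}. ?A $$ (i, \<pi> i)) =
        (\<Prod>i\<in>{0..<N}. \<Sum>m\<in>S. laurent_monom m (x m i * y m (\<pi> i)))"
      by (intro prod.cong) (auto simp: lt)
    also have "\<dots> = (\<Sum>g\<in>?G. \<Prod>i\<in>{0..<N}. laurent_monom (g i) (x (g i) i * y (g i) (\<pi> i)))"
      by (rule prod_sum_PiE) (use assms in auto)
    finally show "signof \<pi> * (\<Prod>i\<in>{0..<N}. ?A $$ (i, \<pi> i)) = signof \<pi> *
      (\<Sum>g\<in>?G. laurent_monom (\<Sum>i\<in>{0..<N}. g i) (\<Prod>i\<in>{0..<N}. x (g i) i * y (g i) (\<pi> i)))"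
      by (simp add: prod_laurent_monom)
  qed
  also have "\<dots> = (\<Sum>g\<in>?G. \<Sum>\<pi>\<in>?P. laurent_monom (\<Sum>i\<in>{0..<N}. g i)
      (signof \<pi> * (\<Prod>i\<in>{0..<N}. x (g i) i * y (g i) (\<pi> i))))"
    by (subst sum.swap) (simp add: sum_distrib_left sg)
  also have "\<dots> = (\<Sum>g\<in>?G. laurent_monom (\<Sum>i\<in>{0..<N}. g i)
       ((\<Prod>i\<in>{0..<N}. x (g i) i) * Determinant.det (Matrix.mat N N (\<lambda>(i, j). y (g i) j))))"
  proof (rule sum.cong[OF refl])
    fix g assume "g \<in> ?G"
    have "Determinant.det (Matrix.mat N N (\<lambda>(i, j). y (g i) j)) =
        (\<Sum>\<pi>\<in>?P. signof \<pi> * (\<Prod>i\<in>{0..<N}. y (g i) (\<pi> i)))"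
      by (subst det_def'[of _ N]) (auto simp: lt intro!: sum.cong prod.cong)
    then show "(\<Sum>\<pi>\<in>?P. laurent_monom (\<Sum>i\<in>{0..<N}. g i)
      (signof \<pi> * (\<Prod>i\<in>{0..<N}. x (g i) i * y (g i) (\<pi> i)))) = laurent_monom (\<Sum>i\<in>{0..<N}. g i)
       ((\<Prod>i\<in>{0..<N}. x (g i) i) * Determinant.det (Matrix.mat N N (\<lambda>(i, j). y (g i) j)))"
      by (simp add: laurent_monom_sum[symmetric] sum_distrib_left prod.distrib mult_ac)
  qed
  finally show ?thesis .
qed

definition affine_coordinate :: "(int ^ 'n::finite) list \<Rightarrow> int ^ 'n \<Rightarrow> int ^ 'n \<Rightarrow> nat \<Rightarrow> complex" where
  "affine_coordinate bs m\<^sub>0 m i = (case i of 0 \<Rightarrow> 1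
     | Suc j \<Rightarrow> of_int (int_vec.representation (set bs) (m - m\<^sub>0) (bs ! j)))"

text \<open>
  Row \<open>i\<close> consists of the homogeneous coordinates \<open>(1, g i - m\<^sub>0)\<close>, so the determinant is nonzero
  exactly when the points \<open>g i\<close> are affinely independent.
\<close>

definition affine_matrix :: "(int ^ 'n::finite) list \<Rightarrow> int ^ 'n \<Rightarrow> (nat \<Rightarrow> int ^ 'n) \<Rightarrow> complex mat" where
  "affine_matrix bs m\<^sub>0 g = Matrix.mat (Suc (length bs)) (Suc (length bs))
     (\<lambda>(i, j). affine_coordinate bs m\<^sub>0 (g i) j)"

text \<open>
  The bordered matrix has entries in the Laurent ring itself, which exhibits
  \<open>q\<^bsup>r+1\<^esup> \<delta>(q)\<close> as a Laurent polynomial.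
\<close>

lemma bordered_det_eq:
  fixes q :: "'n::finite laurent" and bs :: "(int ^ 'n) list"
  assumes "q \<noteq> 0"
  defines "r \<equiv> length bs"
    and "D \<equiv> \<lambda>i. euler_op (set bs) (bs ! i)"
  shows "Fract (Determinant.det (Matrix.mat (Suc r) (Suc r) (\<lambda>(i, j). case i of
      0 \<Rightarrow> (case j of 0 \<Rightarrow> q | Suc j' \<Rightarrow> D j' q)
    | Suc i' \<Rightarrow> (case j of 0 \<Rightarrow> D i' q | Suc j' \<Rightarrow> D i' (D j' q))))) 1 =
    Fract (q ^ Suc r) 1 * Determinant.det (Matrix.mat r r (\<lambda>(i, j). log_hessian (set bs) q (bs ! i) (bs ! j)))"
    (is "Fract (Determinant.det ?A) 1 = _")
proof -
  let ?h = "\<lambda>x :: 'n laurent. Fract x 1"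
  interpret comm_ring_hom ?h
    by unfold_locales (auto simp: Zero_fract_def One_fract_def)
  have "?h q \<noteq> ?h 0" using assms(1) eq_fract(1)[of 1 1 q 0] by auto
  then have hq: "?h q \<noteq> 0" by simp
  have "?h (Determinant.det ?A) = Determinant.det (map_mat ?h ?A)" by simp
  also have "map_mat ?h ?A = Matrix.mat (Suc r) (Suc r) (\<lambda>(i, j). case i of
      0 \<Rightarrow> (case j of 0 \<Rightarrow> ?h q | Suc j' \<Rightarrow> ?h (D j' q))
    | Suc i' \<Rightarrow> (case j of 0 \<Rightarrow> ?h (D i' q) | Suc j' \<Rightarrow> ?h (D i' (D j' q))))"
    by (rule eq_matI) (auto split: nat.splits)
  also have "Determinant.det \<dots> = ?h q ^ Suc r * Determinant.det (Matrix.mat r r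
      (\<lambda>(i, j). (?h q * ?h (D i (D j q)) - ?h (D i q) * ?h (D j q)) / ?h q ^ 2))"
    by (rule det_bordered[where Q = "?h q" and v = "\<lambda>i. ?h (D i q)" and H = "\<lambda>i j. ?h (D i (D j q))", OF hq])
  also have "(\<lambda>(i, j). (?h q * ?h (D i (D j q)) - ?h (D i q) * ?h (D j q)) / ?h q ^ 2) =
      (\<lambda>(i, j). log_hessian (set bs) q (bs ! i) (bs ! j))"
    by (auto simp: log_hessian_def D_def power2_eq_square)
  also have "?h q ^ Suc r = ?h (q ^ Suc r)" by (rule hom_power[symmetric])
  finally show ?thesis .
qed

text \<open>
  Multiplying each row of the bordered matrix of \<open>\<chi>\<^bsup>-m\<^sub>0\<^esup> p\<close> by \<open>\<chi>\<^bsup>m\<^sub>0\<^esup>\<close> turns its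
  determinant into \<open>\<mu>(p)\<close>, and its entries into sums of
  \<open>c\<^sub>m \<chi>\<^sup>m\<close> weighted by products of two affine coordinates of \<open>m\<close>.
\<close>

lemma mu_expansion:
  fixes p :: "'n::finite laurent"
  assumes p: "p \<noteq> 0" and basis: "lattice_basis B (UNIV :: (int ^ 'n) set)"
    and full: "difference_lattice p = UNIV"
  shows "\<exists>bs m\<^sub>0. distinct bs \<and> lattice_basis (set bs) (UNIV :: (int ^ 'n) set) \<and> length bs = CARD('n) \<and>
    mu p = (\<Sum>g\<in>PiE {0..<Suc CARD('n)} (\<lambda>_. supp p). laurent_monom (\<Sum>i\<in>{0..<Suc CARD('n)}. g i)
       ((\<Prod>i\<in>{0..<Suc CARD('n)}. coefficient p (g i) * affine_coordinate bs m\<^sub>0 (g i) i) *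
        Determinant.det (affine_matrix bs m\<^sub>0 g)))"
proof -
  define bs :: "(int ^ 'n) list" where "bs = chosen_basis UNIV"
  define m\<^sub>0 where "m\<^sub>0 = (SOME m. m \<in> supp p)"
  define q where "q = laurent_monom (- m\<^sub>0) 1 * p"
  define D where "D i = euler_op (set bs) (bs ! i)" for i
  define N where "N = Suc (length bs)"
  interpret B: lattice_with_basis B by unfold_locales (rule basis)
  have "\<exists>bs. distinct bs \<and> lattice_basis (set bs) (UNIV :: (int ^ 'n) set)"
    using basis finite_distinct_list[OF B.finite_basis] by metis
  then have bs: "distinct bs" "lattice_basis (set bs) UNIV"
    unfolding bs_def chosen_basis_def by (metis (mono_tags, lifting) someI_ex)+
  interpret C: lattice_with_basis "set bs" by unfold_locales (rule bs(2))
  have len: "length bs = CARD('n)" using C.card_basis distinct_card[OF bs(1)] by simp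
  have pq: "p = laurent_monom m\<^sub>0 1 * q"
    by (simp add: q_def mult.assoc[symmetric] laurent_monom_mult laurent_monom_0_1)
  then have "q \<noteq> 0" using p by auto
  define A where "A = Matrix.mat N N (\<lambda>(i, j). case i of
      0 \<Rightarrow> (case j of 0 \<Rightarrow> q | Suc j' \<Rightarrow> D j' q)
    | Suc i' \<Rightarrow> (case j of 0 \<Rightarrow> D i' q | Suc j' \<Rightarrow> D i' (D j' q)))"
  have A_carrier: "A \<in> carrier_mat N N" by (simp add: A_def)
  have "Fract (Determinant.det (laurent_monom m\<^sub>0 1 \<cdot>\<^sub>m A)) 1 =
      Fract (laurent_monom m\<^sub>0 1 ^ N) 1 * Fract (Determinant.det A) 1"
    using A_carrier by simp
  also have "Fract (Determinant.det A) 1 = Fract (q ^ N) 1 * delta UNIV q"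
    unfolding A_def N_def D_def bordered_det_eq[OF \<open>q \<noteq> 0\<close>] delta_def Let_def bs_def[symmetric] ..
  also have "Fract (laurent_monom m\<^sub>0 1 ^ N) 1 * (Fract (q ^ N) 1 * delta UNIV q) = Fract (p ^ N) 1 * delta UNIV q"
    unfolding pq by (simp add: power_mult_distrib mult.assoc[symmetric])
  finally have *: "Fract (Determinant.det (laurent_monom m\<^sub>0 1 \<cdot>\<^sub>m A)) 1 = Fract (p ^ N) 1 * delta UNIV q" .
  have "mu p = (THE f. Fract f 1 = Fract (p ^ N) 1 * delta UNIV q)"
    unfolding mu_def Let_def full lattice_rank_def bs_def[symmetric] N_def
    by (simp add: q_def m\<^sub>0_def)
  also have "\<dots> = Determinant.det (laurent_monom m\<^sub>0 1 \<cdot>\<^sub>m A)"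
    unfolding *[symmetric] by (rule the_equality) (auto simp: eq_fract)
  also have "laurent_monom m\<^sub>0 1 \<cdot>\<^sub>m A = Matrix.mat N N (\<lambda>(i, j). \<Sum>m\<in>supp p.
      laurent_monom m ((coefficient p m * affine_coordinate bs m\<^sub>0 m i) * affine_coordinate bs m\<^sub>0 m j))"
  proof (rule eq_matI)
    fix i j assume ij: "i < dim_row (Matrix.mat N N (\<lambda>(i, j). \<Sum>m\<in>supp p.
        laurent_monom m ((coefficient p m * affine_coordinate bs m\<^sub>0 m i) * affine_coordinate bs m\<^sub>0 m j)))"
      "j < dim_col (Matrix.mat N N (\<lambda>(i, j). \<Sum>m\<in>supp p.
        laurent_monom m ((coefficient p m * affine_coordinate bs m\<^sub>0 m i) * affine_coordinate bs m\<^sub>0 m j)))"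
    then have lt: "i < N" "j < N" by auto
    have q: "coefficient q (k - m\<^sub>0) = coefficient p k" for k
      by (simp add: q_def coefficient_monom_mult)
    have "laurent_monom m\<^sub>0 1 * A $$ (i, j) = (\<Sum>m\<in>supp p.
      laurent_monom m ((coefficient p m * affine_coordinate bs m\<^sub>0 m i) * affine_coordinate bs m\<^sub>0 m j))"
    proof (rule laurent_eqI)
      fix k
      have "coefficient (A $$ (i, j)) (k - m\<^sub>0) =
          coefficient p k * affine_coordinate bs m\<^sub>0 k i * affine_coordinate bs m\<^sub>0 k j"
        using lt by (auto simp: A_def D_def coefficient_euler_op q affine_coordinate_def split: nat.splits)
      then show "coefficient (laurent_monom m\<^sub>0 1 * A $$ (i, j)) k = coefficient (\<Sum>m\<in>supp p.
        laurent_monom m ((coefficient p m * affine_coordinate bs m\<^sub>0 m i) * affine_coordinate bs m\<^sub>0 m j)) k"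
        by (auto simp: coefficient_monom_mult coefficient_sum supp_conv_coefficient
            finite_supp[unfolded supp_conv_coefficient])
    qed
    then show "(laurent_monom m\<^sub>0 1 \<cdot>\<^sub>m A) $$ (i, j) = Matrix.mat N N (\<lambda>(i, j). \<Sum>m\<in>supp p.
        laurent_monom m ((coefficient p m * affine_coordinate bs m\<^sub>0 m i) * affine_coordinate bs m\<^sub>0 m j)) $$ (i, j)"
      using lt A_carrier by simp
  qed (use A_carrier in auto)
  also have "Determinant.det \<dots> = (\<Sum>g\<in>PiE {0..<N} (\<lambda>_. supp p). laurent_monom (\<Sum>i\<in>{0..<N}. g i)
       ((\<Prod>i\<in>{0..<N}. coefficient p (g i) * affine_coordinate bs m\<^sub>0 (g i) i) *
        Determinant.det (affine_matrix bs m\<^sub>0 g)))"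
    unfolding affine_matrix_def N_def by (rule det_sum_of_monomials) simp
  finally show ?thesis unfolding N_def len using bs len by blast
qed

section \<open>Affine determinants\<close>

notation Matrix.vec_index (infixl "$v" 100)

lemma int_pairing_expansion:
  assumes bs: "distinct bs" "lattice_basis (set bs) (UNIV :: (int ^ 'n::finite) set)"
  shows "int_pairing u m = (\<Sum>j<length bs. int_vec.representation (set bs) m (bs ! j) * int_pairing u (bs ! j))"
proof -
  interpret lattice_with_basis "set bs" by unfold_locales (rule bs(2))
  have "int_pairing u m = int_pairing u (\<Sum>b\<in>set bs. int_vec.representation (set bs) m b *s b)"
    by (simp only: int_expansion)
  also have "\<dots> = (\<Sum>b\<in>set bs. int_vec.representation (set bs) m b * int_pairing u b)"
    by (simp only: int_pairing_sum int_pairing_scale)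
  also have "\<dots> = (\<Sum>j<length bs. int_vec.representation (set bs) m (bs ! j) * int_pairing u (bs ! j))"
    using bs(1) by (intro sum.reindex_bij_betw[symmetric] bij_betw_nth) auto
  finally show ?thesis .
qed

lemma affine_matrix_mult_vec:
  assumes z: "z \<in> carrier_vec (Suc (length bs))" and i: "i < Suc (length bs)"
  shows "(affine_matrix bs m\<^sub>0 g *\<^sub>v z) $v i =
    z $v 0 + (\<Sum>j<length bs. of_int (int_vec.representation (set bs) (g i - m\<^sub>0) (bs ! j)) * z $v (Suc j))"
proof -
  have "(affine_matrix bs m\<^sub>0 g *\<^sub>v z) $v i = (\<Sum>j<Suc (length bs). affine_coordinate bs m\<^sub>0 (g i) j * z $v j)"
    using z i by (simp add: affine_matrix_def scalar_prod_def atLeast0LessThan)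
  also have "\<dots> = z $v 0 + (\<Sum>j<length bs. of_int (int_vec.representation (set bs) (g i - m\<^sub>0) (bs ! j)) * z $v (Suc j))"
    by (subst sum.lessThan_Suc_shift) (simp add: affine_coordinate_def)
  finally show ?thesis .
qed

text \<open>
  A functional that is constant on the points \<open>g i\<close> gives an affine function vanishing on all of
  them, that is, a nonzero kernel vector of the affine matrix.
\<close>

lemma pairing_not_constant_of_det_nonzero:
  assumes bs: "distinct bs" "lattice_basis (set bs) (UNIV :: (int ^ 'n::finite) set)"
    and det: "Determinant.det (affine_matrix bs m\<^sub>0 g) \<noteq> 0" and "u \<noteq> 0"
  shows "\<exists>i<Suc (length bs). int_pairing u (g i) \<noteq> c"
proof (rule ccontr)
  assume "\<not> ?thesis"
  then have const: "int_pairing u (g i) = c" if "i < Suc (length bs)" for i using that by blast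
  \<comment> \<open>The affine function \<open>m \<mapsto> int_pairing u m - c\<close>, written in the coordinates at \<open>m\<^sub>0\<close>.\<close>
  define z where "z = Matrix.vec (Suc (length bs)) (\<lambda>i. case i of
      0 \<Rightarrow> complex_of_int (int_pairing u m\<^sub>0 - c) | Suc j \<Rightarrow> of_int (int_pairing u (bs ! j)))"
  have zc: "z \<in> carrier_vec (Suc (length bs))" by (simp add: z_def)
  have "affine_matrix bs m\<^sub>0 g *\<^sub>v z = 0\<^sub>v (Suc (length bs))"
  proof (rule eq_vecI)
    fix i assume "i < dim_vec (0\<^sub>v (Suc (length bs)) :: complex Matrix.vec)"
    then have i: "i < Suc (length bs)" by simp
    have "(affine_matrix bs m\<^sub>0 g *\<^sub>v z) $v i =
        of_int (int_pairing u m\<^sub>0 - c + (\<Sum>j<length bs. int_vec.representation (set bs) (g i - m\<^sub>0) (bs ! j) * int_pairing u (bs ! j)))"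
      unfolding affine_matrix_mult_vec[OF zc i] by (simp add: z_def)
    also have "\<dots> = 0"
      unfolding int_pairing_expansion[OF bs, symmetric] int_pairing_diff using const[OF i] by simp
    finally show "(affine_matrix bs m\<^sub>0 g *\<^sub>v z) $v i = 0\<^sub>v (Suc (length bs)) $v i" using i by simp
  qed (simp add: affine_matrix_def)
  moreover have "z \<noteq> 0\<^sub>v (Suc (length bs))"
  proof
    assume "z = 0\<^sub>v (Suc (length bs))"
    then have "z $v Suc j = 0" if "j < length bs" for j using that by simp
    then have "int_pairing u (bs ! j) = 0" if "j < length bs" for j using that by (simp add: z_def)
    then have *: "int_pairing u m = 0" for m by (subst int_pairing_expansion[OF bs]) simp
    have "real_vec u \<bullet> real_vec u = 0" unfolding inner_real_vec * by simp
    then show False using \<open>u \<noteq> 0\<close> by simp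
  qed
  moreover have "affine_matrix bs m\<^sub>0 g \<in> carrier_mat (Suc (length bs)) (Suc (length bs))"
    by (simp add: affine_matrix_def)
  ultimately show False using det det_0_iff_vec_prod_zero zc by blast
qed

text \<open>
  A kernel vector is an affine function vanishing at \<open>v\<close> and at all \<open>v + b\<close>. Its linear part \<open>\<phi>\<close>
  vanishes on the basis \<open>B\<close>, hence everywhere.
\<close>

lemma det_affine_matrix_of_lattice_basis:
  assumes bs: "distinct bs" "lattice_basis (set bs) (UNIV :: (int ^ 'n::finite) set)"
    and B: "lattice_basis B (UNIV :: (int ^ 'n) set)"
    and g: "g 0 = v" "(\<lambda>i. g (Suc i)) ` {..<length bs} = (+) v ` B"
  shows "Determinant.det (affine_matrix bs m\<^sub>0 g) \<noteq> 0"
proof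
  assume "Determinant.det (affine_matrix bs m\<^sub>0 g) = 0"
  moreover have "affine_matrix bs m\<^sub>0 g \<in> carrier_mat (Suc (length bs)) (Suc (length bs))"
    by (simp add: affine_matrix_def)
  ultimately obtain z where z: "z \<in> carrier_vec (Suc (length bs))" "z \<noteq> 0\<^sub>v (Suc (length bs))"
      "affine_matrix bs m\<^sub>0 g *\<^sub>v z = 0\<^sub>v (Suc (length bs))"
    using det_0_iff_vec_prod_zero by blast
  interpret C: lattice_with_basis "set bs" by unfold_locales (rule bs(2))
  interpret B: lattice_with_basis B by unfold_locales (rule B)
  define \<phi> where "\<phi> m = (\<Sum>j<length bs. of_int (int_vec.representation (set bs) m (bs ! j)) * z $v (Suc j))" for m
  have zero: "z $v 0 + \<phi> (g i - m\<^sub>0) = 0" if "i < Suc (length bs)" for i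
    using affine_matrix_mult_vec[OF z(1) that, of m\<^sub>0 g] that unfolding z(3) \<phi>_def by simp
  have \<phi>_add: "\<phi> (x + y) = \<phi> x + \<phi> y" for x y
    by (simp add: \<phi>_def int_vec.representation_add C.independent C.span algebra_simps sum.distrib)
  have \<phi>_scale: "\<phi> (k *s x) = of_int k * \<phi> x" for k x
    by (simp add: \<phi>_def int_vec.representation_scale C.independent C.span sum_distrib_left mult_ac)
  have \<phi>_zero: "\<phi> 0 = 0" using \<phi>_scale[of 0 0] by simp
  have \<phi>_B: "\<phi> b = 0" if "b \<in> B" for b
  proof -
    have "v + b \<in> (\<lambda>i. g (Suc i)) ` {..<length bs}" unfolding g(2) using that by (rule imageI)
    then obtain i where i: "i < length bs" "g (Suc i) = v + b" by auto
    have "z $v 0 + \<phi> (g (Suc i) - m\<^sub>0) = z $v 0 + \<phi> (g 0 - m\<^sub>0)"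
      using zero[of 0] zero[of "Suc i"] i(1) by simp
    then have "\<phi> (g (Suc i) - m\<^sub>0) = \<phi> (g 0 - m\<^sub>0)" by simp
    moreover have "g (Suc i) - m\<^sub>0 = (g 0 - m\<^sub>0) + b" using i g(1) by simp
    ultimately show ?thesis by (simp only: \<phi>_add) simp
  qed
  have \<phi>: "\<phi> m = 0" for m
  proof -
    have "m \<in> int_vec.span B" by (simp add: B.span)
    then show ?thesis
      by (induction rule: int_vec.span_induct_alt) (simp_all add: \<phi>_zero \<phi>_add \<phi>_scale \<phi>_B)
  qed
  have "z $v i = 0" if "i < Suc (length bs)" for i
  proof (cases i)
    case 0
    then show ?thesis using zero[of 0] \<phi> by simp
  next
    case (Suc j)
    then have j: "j < length bs" using that by simp
    have "\<phi> (bs ! j) = (\<Sum>k<length bs. if k = j then z $v Suc j else 0)"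
      unfolding \<phi>_def using j bs(1)
      by (intro sum.cong) (auto simp: int_vec.representation_basis C.independent nth_eq_iff_index_eq)
    then show ?thesis using \<phi>[of "bs ! j"] j Suc by simp
  qed
  then have "z = 0\<^sub>v (Suc (length bs))" using z(1) by (intro eq_vecI) auto
  then show False using z(2) by simp
qed

text \<open>
  Permuting the rows multiplies the inner determinant by the sign; the signs and the diagonal
  products then add up to a second copy of the determinant.
\<close>

lemma sum_over_permuted_rows:
  fixes y :: "'a \<Rightarrow> nat \<Rightarrow> complex"
  shows "(\<Sum>\<pi> | \<pi> permutes {0..<N}. (\<Prod>i\<in>{0..<N}. c (g (\<pi> i)) * y (g (\<pi> i)) i) *
      Determinant.det (Matrix.mat N N (\<lambda>(i, j). y (g (\<pi> i)) j))) =
    (\<Prod>i\<in>{0..<N}. c (g i)) * Determinant.det (Matrix.mat N N (\<lambda>(i, j). y (g i) j)) ^ 2"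
proof -
  let ?A = "Matrix.mat N N (\<lambda>(i, j). y (g i) j)"
  have A: "?A \<in> carrier_mat N N" by simp
  have det_A: "(\<Sum>\<pi> | \<pi> permutes {0..<N}. signof \<pi> * (\<Prod>i\<in>{0..<N}. ?A $$ (\<pi> i, i))) = Determinant.det ?A"
    using det_col[OF A] by (simp only: atLeast0LessThan)
  have lt: "\<pi> i < N" if "\<pi> permutes {0..<N}" "i < N" for \<pi> i
    using permutes_in_image[OF that(1), of i] that(2) by simp
  have "(\<Sum>\<pi> | \<pi> permutes {0..<N}. (\<Prod>i\<in>{0..<N}. c (g (\<pi> i)) * y (g (\<pi> i)) i) *
      Determinant.det (Matrix.mat N N (\<lambda>(i, j). y (g (\<pi> i)) j))) =
    (\<Sum>\<pi> | \<pi> permutes {0..<N}. ((\<Prod>i\<in>{0..<N}. c (g i)) * Determinant.det ?A) *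
      (signof \<pi> * (\<Prod>i\<in>{0..<N}. ?A $$ (\<pi> i, i))))"
  proof (rule sum.cong[OF refl], clarify)
    fix \<pi> assume \<pi>: "\<pi> permutes {0..<N}"
    have "Matrix.mat N N (\<lambda>(i, j). y (g (\<pi> i)) j) = Matrix.mat N N (\<lambda>(i, j). ?A $$ (\<pi> i, j))"
      using lt[OF \<pi>] by (intro eq_matI) auto
    then have "Determinant.det (Matrix.mat N N (\<lambda>(i, j). y (g (\<pi> i)) j)) = signof \<pi> * Determinant.det ?A"
      using det_permute_rows[OF A \<pi>] by simp
    moreover have "(\<Prod>i\<in>{0..<N}. c (g (\<pi> i))) = (\<Prod>i\<in>{0..<N}. c (g i))"
      using prod.permute[OF \<pi>, of "\<lambda>i. c (g i)"] by (simp add: comp_def)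
    moreover have "(\<Prod>i\<in>{0..<N}. y (g (\<pi> i)) i) = (\<Prod>i\<in>{0..<N}. ?A $$ (\<pi> i, i))"
      using lt[OF \<pi>] by (intro prod.cong) auto
    ultimately show "(\<Prod>i\<in>{0..<N}. c (g (\<pi> i)) * y (g (\<pi> i)) i) *
      Determinant.det (Matrix.mat N N (\<lambda>(i, j). y (g (\<pi> i)) j)) =
      ((\<Prod>i\<in>{0..<N}. c (g i)) * Determinant.det ?A) * (signof \<pi> * (\<Prod>i\<in>{0..<N}. ?A $$ (\<pi> i, i)))"
      by (simp add: prod.distrib mult_ac)
  qed
  also have "\<dots> = ((\<Prod>i\<in>{0..<N}. c (g i)) * Determinant.det ?A) * Determinant.det ?A"
    unfolding sum_distrib_left[symmetric] det_A ..
  finally show ?thesis by (simp add: power2_eq_square mult.assoc)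
qed

section \<open>The support of \<open>\<mu>(p)\<close>\<close>

lemma bij_betw_permutations_enumerations:
  assumes "finite I" and inj: "inj_on g\<^sub>0 I"
  shows "bij_betw (\<lambda>\<sigma>. restrict (g\<^sub>0 \<circ> \<sigma>) I) {\<sigma>. \<sigma> permutes I} {g \<in> extensional I. g ` I = g\<^sub>0 ` I}"
proof (rule bij_betwI')
  fix \<sigma> \<tau> assume \<sigma>\<tau>: "\<sigma> \<in> {\<sigma>. \<sigma> permutes I}" "\<tau> \<in> {\<sigma>. \<sigma> permutes I}"
  show "restrict (g\<^sub>0 \<circ> \<sigma>) I = restrict (g\<^sub>0 \<circ> \<tau>) I \<longleftrightarrow> \<sigma> = \<tau>"
  proof
    assume eq: "restrict (g\<^sub>0 \<circ> \<sigma>) I = restrict (g\<^sub>0 \<circ> \<tau>) I"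
    show "\<sigma> = \<tau>"
    proof
      fix i
      show "\<sigma> i = \<tau> i"
      proof (cases "i \<in> I")
        case True
        then have "g\<^sub>0 (\<sigma> i) = g\<^sub>0 (\<tau> i)" using fun_cong[OF eq, of i] by simp
        then show ?thesis using \<sigma>\<tau> True inj by (simp add: inj_on_eq_iff permutes_in_image)
      next
        case False
        then show ?thesis using \<sigma>\<tau> by (simp add: permutes_not_in)
      qed
    qed
  qed simp
next
  fix \<sigma> assume "\<sigma> \<in> {\<sigma>. \<sigma> permutes I}"
  then have "\<sigma> ` I = I" by (simp add: permutes_image)
  then have "(\<lambda>i. g\<^sub>0 (\<sigma> i)) ` I = g\<^sub>0 ` I" by (metis image_image)
  then show "restrict (g\<^sub>0 \<circ> \<sigma>) I \<in> {g \<in> extensional I. g ` I = g\<^sub>0 ` I}"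
    by (simp add: comp_def)
next
  fix g assume g: "g \<in> {g \<in> extensional I. g ` I = g\<^sub>0 ` I}"
  then have "card (g ` I) = card I" using card_image[OF inj] by simp
  then have "inj_on g I" using assms(1) eq_card_imp_inj_on by blast
  then have "bij_betw g I (g\<^sub>0 ` I)" using g by (simp add: bij_betw_def)
  moreover have "bij_betw (inv_into I g\<^sub>0) (g\<^sub>0 ` I) I"
    using inj by (simp add: bij_betw_inv_into inj_on_imp_bij_betw)
  ultimately have bij: "bij_betw (inv_into I g\<^sub>0 \<circ> g) I I" by (rule bij_betw_trans)
  define \<sigma> where "\<sigma> i = (if i \<in> I then inv_into I g\<^sub>0 (g i) else i)" for i
  have "bij_betw \<sigma> I I" using bij by (rule bij_betw_cong[THEN iffD1, rotated]) (simp add: \<sigma>_def)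
  then have "\<sigma> permutes I" by (rule bij_imp_permutes) (simp add: \<sigma>_def)
  moreover have "g = restrict (g\<^sub>0 \<circ> \<sigma>) I"
  proof
    fix i
    have "g i \<in> g\<^sub>0 ` I" if "i \<in> I" using g that by blast
    then show "g i = restrict (g\<^sub>0 \<circ> \<sigma>) I i"
      using g by (auto simp: \<sigma>_def f_inv_into_f extensional_def)
  qed
  ultimately show "\<exists>\<sigma>\<in>{\<sigma>. \<sigma> permutes I}. g = restrict (g\<^sub>0 \<circ> \<sigma>) I" by blast
qed

lemma sum_nonneg_int_eq_1:
  fixes f :: "'a \<Rightarrow> int"
  assumes "finite I" and nonneg: "\<And>i. i \<in> I \<Longrightarrow> f i \<ge> 0" and "sum f I = 1"
  obtains i where "i \<in> I" "\<And>j. j \<in> I \<Longrightarrow> f j = (if j = i then 1 else 0)"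
proof -
  have "\<not> (\<forall>i\<in>I. f i = 0)" using assms(3) sum.neutral[of I f] by force
  then obtain i where i: "i \<in> I" "f i \<noteq> 0" by blast
  have "f i + sum f (I - {i}) = 1" using sum.remove[OF assms(1) i(1), of f] assms(3) by simp
  moreover have "sum f (I - {i}) \<ge> 0" by (intro sum_nonneg) (use nonneg in auto)
  moreover have "f i \<ge> 1" using nonneg[OF i(1)] i(2) by linarith
  ultimately have "f i = 1" "sum f (I - {i}) = 0" by linarith+
  then have "\<forall>j\<in>I - {i}. f j = 0"
    using sum_nonneg_eq_0_iff[of "I - {i}" f] assms(1) nonneg by auto
  then show ?thesis using that[of i] i(1) \<open>f i = 1\<close> by auto
qed

lemma edge_basis_pairing_le:
  assumes "edge_basis S v B" "b \<in> B" "m \<in> S"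
  shows "int_pairing (dual_vector B b) v \<le> int_pairing (dual_vector B b) m"
proof -
  have "real_vec m \<in> convex hull (real_vec ` S)" using assms(3) by (intro hull_inc imageI)
  then have "real_vec (dual_vector B b) \<bullet> real_vec v \<le> real_vec (dual_vector B b) \<bullet> real_vec m"
    using assms by (auto simp: edge_basis_def)
  then show ?thesis by (simp add: inner_real_vec)
qed

text \<open>
  In the coordinates at \<open>v\<close> given by \<open>B\<close>, the points \<open>g i\<close> have nonnegative integral coordinates
  and the coordinates of their sum are all \<open>1\<close>. So for every \<open>b\<close> exactly one point, with index
  \<open>\<phi> b\<close>, has a nonzero \<open>b\<close>-coordinate, and this coordinate is \<open>1\<close>. If \<open>\<phi> b = \<phi> c\<close> for \<open>b \<noteq> c\<close>,
  then the \<open>b\<close>- and \<open>c\<close>-coordinates would agree on all points, against affine independence. Hence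
  \<open>g (\<phi> b) = v + b\<close>, and the one remaining index gives the point \<open>v\<close> with all coordinates \<open>0\<close>.
\<close>

lemma affine_basis_with_vertex_sum:
  fixes B :: "(int ^ 'n::finite) set"
  assumes bs: "distinct bs" "lattice_basis (set bs) (UNIV :: (int ^ 'n) set)" "length bs = CARD('n)"
    and B: "edge_basis S v B" and gS: "\<And>i. i < Suc CARD('n) \<Longrightarrow> g i \<in> S"
    and sum: "(\<Sum>i\<in>{0..<Suc CARD('n)}. g i) = int (Suc CARD('n)) *s v + \<Sum>B"
    and det: "Determinant.det (affine_matrix bs m\<^sub>0 g) \<noteq> 0"
  shows "g ` {0..<Suc CARD('n)} = insert v ((+) v ` B)"
proof -
  interpret lattice_with_basis B by unfold_locales (use B edge_basis_def in blast)
  define I where "I = {0..<Suc CARD('n)}"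
  define y where "y i b = int_pairing (dual_vector B b) (g i - v)" for i b
  have y_nonneg: "y i b \<ge> 0" if "i \<in> I" "b \<in> B" for i b
    using edge_basis_pairing_le[OF B that(2) gS[of i]] that(1) by (simp add: y_def int_pairing_diff I_def)
  have dual: "int_pairing (dual_vector B b) c = (if c = b then 1 else 0)" if "b \<in> B" "c \<in> B" for b c
    using that by (simp add: int_pairing_dual_vector int_vec.representation_basis independent)
  have y_sum: "(\<Sum>i\<in>I. y i b) = 1" if b: "b \<in> B" for b
  proof -
    have "(\<Sum>i\<in>I. y i b) = int_pairing (dual_vector B b) (\<Sum>i\<in>I. g i) - int (card I) * int_pairing (dual_vector B b) v"
      by (simp add: y_def int_pairing_diff int_pairing_sum sum_subtractf)
    also have "\<dots> = int_pairing (dual_vector B b) (\<Sum>B)"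
      unfolding I_def sum by (simp add: int_pairing_add int_pairing_scale del: of_nat_Suc)
    also have "\<dots> = 1" using b finite_basis by (simp add: int_pairing_sum dual if_distrib cong: if_cong)
    finally show ?thesis .
  qed
  have "\<exists>i. i \<in> I \<and> (\<forall>j\<in>I. y j b = (if j = i then 1 else 0))" if "b \<in> B" for b
    using sum_nonneg_int_eq_1[of I "\<lambda>i. y i b"] y_nonneg y_sum that by (metis I_def finite_atLeastLessThan)
  then obtain \<phi> where \<phi>: "\<And>b. b \<in> B \<Longrightarrow> \<phi> b \<in> I"
      "\<And>b j. b \<in> B \<Longrightarrow> j \<in> I \<Longrightarrow> y j b = (if j = \<phi> b then 1 else 0)" by metis
  have inj: "inj_on \<phi> B"
  proof (rule inj_onI, rule ccontr)
    fix b c assume bc: "b \<in> B" "c \<in> B" "\<phi> b = \<phi> c" "b \<noteq> c"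
    let ?u = "dual_vector B b - dual_vector B c"
    have "int_pairing ?u b = 1" using bc by (simp add: int_pairing_diff_left dual)
    then have "?u \<noteq> 0" by (auto simp: int_pairing_def)
    then obtain i where i: "i < Suc (length bs)" "int_pairing ?u (g i) \<noteq> int_pairing ?u v"
      using pairing_not_constant_of_det_nonzero[OF bs(1,2) det, of ?u "int_pairing ?u v"] by blast
    then have "i \<in> I" using bs(3) by (simp add: I_def)
    then have "y i b = y i c" using bc \<phi>(2) by simp
    then show False using i(2) by (simp add: y_def int_pairing_diff_left int_pairing_diff)
  qed
  have g_eq: "g i - v = (\<Sum>b\<in>B. y i b *s b)" for i
    unfolding y_def int_pairing_dual_vector by (rule int_expansion[symmetric])
  have g\<phi>: "g (\<phi> b) = v + b" if b: "b \<in> B" for b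
  proof -
    have "g (\<phi> b) - v = (\<Sum>c\<in>B. if c = b then b else 0)"
      unfolding g_eq using \<phi> b inj by (intro sum.cong) (auto simp: inj_on_eq_iff)
    also have "\<dots> = b" using b finite_basis by simp
    finally show ?thesis by (simp add: algebra_simps)
  qed
  \<comment> \<open>There are \<open>n + 1\<close> points but only \<open>n\<close> coordinates.\<close>
  have "card (\<phi> ` B) < card I" using card_image[OF inj] by (simp add: card_basis I_def)
  then have "\<not> I \<subseteq> \<phi> ` B" using card_mono[of "\<phi> ` B" I] finite_basis by fastforce
  then obtain i where i: "i \<in> I" "i \<notin> \<phi> ` B" by blast
  have "g i - v = 0" unfolding g_eq using \<phi>(2) i by (intro sum.neutral) auto
  then have "g i = v" by simp
  have sub: "insert v ((+) v ` B) \<subseteq> g ` I"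
  proof
    fix x assume "x \<in> insert v ((+) v ` B)"
    then consider "x = g i" | b where "b \<in> B" "x = g (\<phi> b)" using \<open>g i = v\<close> g\<phi> by auto
    then show "x \<in> g ` I" using i(1) \<phi>(1) by cases auto
  qed
  have "0 \<notin> B" using independent int_vec.dependent_zero by blast
  then have "card (insert v ((+) v ` B)) = Suc CARD('n)"
    using finite_basis card_basis by (subst card_insert_disjoint) (auto simp: card_image)
  then have "card (g ` I) \<le> card (insert v ((+) v ` B))"
    using card_image_le[of I g] by (simp add: I_def)
  then have "insert v ((+) v ` B) = g ` I" using sub by (intro card_seteq) (simp_all add: I_def)
  then show ?thesis by (simp add: I_def)
qed

lemma difference_lattice_eq_UNIV:
  assumes B: "edge_basis (supp p) v B" and v: "v \<in> supp p"
  shows "difference_lattice p = UNIV"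
proof -
  interpret lattice_with_basis B by unfold_locales (use B edge_basis_def in blast)
  have "real_vec b \<in> {real_vec x - real_vec y | x y. x \<in> supp p \<and> y \<in> supp p}" if "b \<in> B" for b
  proof -
    have "v + b \<in> supp p" using B that by (simp add: edge_basis_def)
    moreover have "real_vec b = real_vec (v + b) - real_vec v" by simp
    ultimately show ?thesis using v by blast
  qed
  then have "real_vec ` B \<subseteq> {real_vec x - real_vec y | x y. x \<in> supp p \<and> y \<in> supp p}" by blast
  then have "Real_Vector_Spaces.span {real_vec x - real_vec y | x y. x \<in> supp p \<and> y \<in> supp p} = UNIV"
    using span_mono real_span by blast
  then show ?thesis by (simp add: difference_lattice_def)
qed

text \<open>
  A tuple that contributes to \<open>\<mu>(p)\<close> is affinely independent, so one of its members lies off the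
  facet where \<open>dual_vector B b\<close> is minimal; by integrality it exceeds the minimum by at least \<open>1\<close>.
\<close>

lemma supp_mu_pairing_ge:
  fixes p :: "'n::finite laurent"
  assumes p: "p \<noteq> 0" and B: "edge_basis (supp p) v B" and v: "v \<in> supp p" and b: "b \<in> B"
    and k: "k \<in> supp (mu p)"
  shows "int_pairing (dual_vector B b) k \<ge> int (Suc CARD('n)) * int_pairing (dual_vector B b) v + 1"
proof -
  interpret lattice_with_basis B by unfold_locales (use B edge_basis_def in blast)
  define I where "I = {0..<Suc CARD('n)}"
  obtain bs m\<^sub>0 where bs: "distinct bs" "lattice_basis (set bs) (UNIV :: (int ^ 'n) set)" "length bs = CARD('n)"
    and mu: "mu p = (\<Sum>g\<in>PiE I (\<lambda>_. supp p). laurent_monom (\<Sum>i\<in>I. g i)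
       ((\<Prod>i\<in>I. coefficient p (g i) * affine_coordinate bs m\<^sub>0 (g i) i) *
        Determinant.det (affine_matrix bs m\<^sub>0 g)))"
    using mu_expansion[OF p basis difference_lattice_eq_UNIV[OF B v]] unfolding I_def by blast
  have "coefficient (mu p) k \<noteq> 0" using k by (simp add: supp_conv_coefficient)
  then obtain g where g: "g \<in> PiE I (\<lambda>_. supp p)" "k = (\<Sum>i\<in>I. g i)"
      "Determinant.det (affine_matrix bs m\<^sub>0 g) \<noteq> 0"
    unfolding mu coefficient_sum by (auto elim!: sum.not_neutral_contains_not_neutral split: if_splits)
  define u where "u = dual_vector B b"
  have ge: "int_pairing u v \<le> int_pairing u (g i)" if "i \<in> I" for i
    unfolding u_def using edge_basis_pairing_le[OF B b] g(1) that by (auto dest: PiE_mem)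
  have "int_pairing u b = 1"
    using b by (simp add: u_def int_pairing_dual_vector int_vec.representation_basis independent)
  then have "u \<noteq> 0" by (auto simp: int_pairing_def)
  then obtain i where i: "i \<in> I" "int_pairing u (g i) \<noteq> int_pairing u v"
    using pairing_not_constant_of_det_nonzero[OF bs(1,2) g(3)] bs(3) unfolding I_def
    by (metis atLeastLessThan_iff zero_le)
  have "(\<Sum>i\<in>I. int_pairing u v) < (\<Sum>i\<in>I. int_pairing u (g i))"
  proof (rule sum_strict_mono_ex1)
    show "\<exists>i\<in>I. int_pairing u v < int_pairing u (g i)"
      using i ge[OF i(1)] by (intro bexI[of _ i]) auto
  qed (use ge in \<open>auto simp: I_def\<close>)
  moreover have "(\<Sum>i\<in>I. int_pairing u v) = int (Suc CARD('n)) * int_pairing u v"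
    by (simp add: I_def)
  ultimately show ?thesis unfolding g(2) u_def[symmetric] int_pairing_sum by linarith
qed

text \<open>
  The contributing tuples are exactly the orderings of \<open>v\<close> and the points \<open>v + b\<close>. Their
  contributions do not cancel: they add up to a nonzero multiple of the square of a nonzero determinant.
\<close>

lemma vertex_sum_in_supp_mu:
  fixes p :: "'n::finite laurent"
  assumes p: "p \<noteq> 0" and B: "edge_basis (supp p) v B" and v: "v \<in> supp p"
  shows "int (Suc CARD('n)) *s v + \<Sum>B \<in> supp (mu p)"
proof -
  interpret lattice_with_basis B by unfold_locales (use B edge_basis_def in blast)
  define N where "N = Suc CARD('n)"
  define I where "I = {0..<N}"
  define k where "k = int N *s v + \<Sum>B"
  obtain bs m\<^sub>0 where bs: "distinct bs" "lattice_basis (set bs) (UNIV :: (int ^ 'n) set)" "length bs = CARD('n)"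
    and mu: "mu p = (\<Sum>g\<in>PiE I (\<lambda>_. supp p). laurent_monom (\<Sum>i\<in>I. g i)
       ((\<Prod>i\<in>I. coefficient p (g i) * affine_coordinate bs m\<^sub>0 (g i) i) *
        Determinant.det (affine_matrix bs m\<^sub>0 g)))"
    using mu_expansion[OF p basis difference_lattice_eq_UNIV[OF B v]] unfolding I_def N_def by blast
  define w where "w g = (\<Prod>i\<in>I. coefficient p (g i) * affine_coordinate bs m\<^sub>0 (g i) i) *
        Determinant.det (Matrix.mat N N (\<lambda>(i, j). affine_coordinate bs m\<^sub>0 (g i) j))" for g
  have affine: "affine_matrix bs m\<^sub>0 g = Matrix.mat N N (\<lambda>(i, j). affine_coordinate bs m\<^sub>0 (g i) j)" for g
    by (simp add: affine_matrix_def bs(3) N_def)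
  obtain bl where bl: "distinct bl" "set bl = B" using finite_distinct_list[OF finite_basis] by blast
  have len: "length bl = CARD('n)" using bl card_basis distinct_card by metis
  define g\<^sub>0 where "g\<^sub>0 i = (case i of 0 \<Rightarrow> v | Suc j \<Rightarrow> v + bl ! j)" for i
  have I_Suc: "I = insert 0 (Suc ` {..<CARD('n)})"
    unfolding I_def N_def by (auto simp: image_iff less_Suc_eq_0_disj)
  have bl_image: "(!) bl ` {..<CARD('n)} = B"
    using bl(2) len by (metis lessThan_atLeast0 list.set_map map_nth set_upt)
  have g0_image: "(\<lambda>i. g\<^sub>0 (Suc i)) ` {..<CARD('n)} = (+) v ` B"
    unfolding bl_image[symmetric] by (simp add: g\<^sub>0_def image_image)
  have g0_I: "g\<^sub>0 ` I = insert v ((+) v ` B)"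
    unfolding I_Suc using g0_image by (simp add: image_image) (simp add: g\<^sub>0_def)
  have g0_supp: "g\<^sub>0 ` I \<subseteq> supp p" unfolding g0_I using B v by (auto simp: edge_basis_def)
  have "0 \<notin> B" using independent int_vec.dependent_zero by blast
  then have "card (g\<^sub>0 ` I) = card I"
    unfolding g0_I using finite_basis card_basis
    by (subst card_insert_disjoint) (auto simp: card_image I_def N_def)
  then have inj: "inj_on g\<^sub>0 I" by (intro eq_card_imp_inj_on) (simp_all add: I_def)
  have g0_sum: "(\<Sum>i\<in>I. g\<^sub>0 i) = k"
  proof -
    have "(\<Sum>i\<in>I. g\<^sub>0 i) = \<Sum>(g\<^sub>0 ` I)" using inj by (simp add: sum.reindex)
    also have "\<dots> = v + (\<Sum>b\<in>B. v + b)"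
      unfolding g0_I using finite_basis \<open>0 \<notin> B\<close> by (subst sum.insert) (auto simp: sum.reindex)
    also have "\<dots> = k"
      unfolding k_def N_def Finite_Cartesian_Product.vec_eq_iff sum_component vector_add_component
        vector_smult_component
      by (simp add: sum.distrib card_basis algebra_simps)
    finally show ?thesis .
  qed
  \<comment> \<open>The orderings of the \<open>n + 1\<close> points; any other tuple of the same sum has determinant \<open>0\<close>.\<close>
  define G where "G = {g \<in> extensional I. g ` I = g\<^sub>0 ` I}"
  have G_sub: "G \<subseteq> PiE I (\<lambda>_. supp p)"
    using g0_supp by (auto simp: G_def PiE_def)
  have bij: "bij_betw (\<lambda>\<sigma>. restrict (g\<^sub>0 \<circ> \<sigma>) I) {\<sigma>. \<sigma> permutes I} G"
    unfolding G_def using inj by (intro bij_betw_permutations_enumerations) (auto simp: I_def)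
  have sum_G: "(\<Sum>i\<in>I. g i) = k" if "g \<in> G" for g
  proof -
    have "card (g ` I) = card I" using that card_image[OF inj] by (simp add: G_def)
    then have "inj_on g I" by (intro eq_card_imp_inj_on) (simp_all add: I_def)
    then have "(\<Sum>i\<in>I. g i) = \<Sum>(g ` I)" by (simp add: sum.reindex)
    also have "\<dots> = \<Sum>(g\<^sub>0 ` I)" using that by (simp add: G_def)
    also have "\<dots> = k" using inj g0_sum by (simp add: sum.reindex)
    finally show ?thesis .
  qed
  have not_G: "w g = 0" if g: "g \<in> PiE I (\<lambda>_. supp p)" "g \<notin> G" "(\<Sum>i\<in>I. g i) = k" for g
  proof (rule ccontr)
    assume "w g \<noteq> 0"
    then have "Determinant.det (affine_matrix bs m\<^sub>0 g) \<noteq> 0" by (auto simp: w_def affine)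
    then have "g ` I = insert v ((+) v ` B)"
      using affine_basis_with_vertex_sum[OF bs B, of g m\<^sub>0] g unfolding I_def N_def k_def by fastforce
    then show False using g by (simp add: G_def g0_I PiE_def)
  qed
  have "coefficient (mu p) k = (\<Sum>g\<in>PiE I (\<lambda>_. supp p). if k = (\<Sum>i\<in>I. g i) then w g else 0)"
    unfolding mu coefficient_sum affine w_def by simp
  also have "\<dots> = (\<Sum>g\<in>G. w g)"
  proof (rule sum.mono_neutral_cong_right)
    show "finite (PiE I (\<lambda>_. supp p))" by (intro finite_PiE) (auto simp: I_def)
  qed (use G_sub not_G sum_G in auto)
  also have "\<dots> = (\<Sum>\<sigma> | \<sigma> permutes I. w (restrict (g\<^sub>0 \<circ> \<sigma>) I))"
    using sum.reindex_bij_betw[OF bij, of w] by simp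
  also have "\<dots> = (\<Sum>\<sigma> | \<sigma> permutes {0..<N}.
      (\<Prod>i\<in>{0..<N}. coefficient p (g\<^sub>0 (\<sigma> i)) * affine_coordinate bs m\<^sub>0 (g\<^sub>0 (\<sigma> i)) i) *
      Determinant.det (Matrix.mat N N (\<lambda>(i, j). affine_coordinate bs m\<^sub>0 (g\<^sub>0 (\<sigma> i)) j)))"
    unfolding I_def
  proof (rule sum.cong[OF refl])
    fix \<sigma>
    have "Matrix.mat N N (\<lambda>(i, j). affine_coordinate bs m\<^sub>0 (restrict (g\<^sub>0 \<circ> \<sigma>) {0..<N} i) j) =
        Matrix.mat N N (\<lambda>(i, j). affine_coordinate bs m\<^sub>0 (g\<^sub>0 (\<sigma> i)) j)"
      by (rule eq_matI) auto
    then show "w (restrict (g\<^sub>0 \<circ> \<sigma>) {0..<N}) =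
      (\<Prod>i\<in>{0..<N}. coefficient p (g\<^sub>0 (\<sigma> i)) * affine_coordinate bs m\<^sub>0 (g\<^sub>0 (\<sigma> i)) i) *
      Determinant.det (Matrix.mat N N (\<lambda>(i, j). affine_coordinate bs m\<^sub>0 (g\<^sub>0 (\<sigma> i)) j))"
      by (simp add: w_def I_def)
  qed
  also have "\<dots> = (\<Prod>i\<in>{0..<N}. coefficient p (g\<^sub>0 i)) * Determinant.det (affine_matrix bs m\<^sub>0 g\<^sub>0) ^ 2"
    unfolding affine by (rule sum_over_permuted_rows)
  finally have coeff: "coefficient (mu p) k = (\<Prod>i\<in>{0..<N}. coefficient p (g\<^sub>0 i)) * Determinant.det (affine_matrix bs m\<^sub>0 g\<^sub>0) ^ 2" .
  have "Determinant.det (affine_matrix bs m\<^sub>0 g\<^sub>0) \<noteq> 0"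
    using g0_image bs(3) by (intro det_affine_matrix_of_lattice_basis[OF bs(1,2) basis, where v = v]) (simp_all add: g\<^sub>0_def)
  moreover have "coefficient p (g\<^sub>0 i) \<noteq> 0" if "i \<in> I" for i
    using g0_supp that by (auto simp: supp_conv_coefficient)
  ultimately have "coefficient (mu p) k \<noteq> 0" unfolding coeff by (simp add: I_def)
  then show ?thesis by (simp add: supp_conv_coefficient k_def N_def)
qed

section \<open>The Newton polytope of \<open>\<mu>(p)\<close>\<close>

text \<open>
  Translates quantification over the rays of the fan into quantification over vertices and their
  edge vectors. A ray arises from several vertices, but its generator and constant do not depend on the
  choice.
\<close>

lemma rays_iff_edge_bases:
  assumes S: "unimodular S"
  defines "P \<equiv> convex hull (real_vec ` S)"
  shows "(\<forall>\<tau>\<in>fan_rays (normal_fan P). R (ray_generator \<tau>) (facet_constant P \<tau>)) \<longleftrightarrow>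
    (\<forall>v B b. real_vec v extreme_point_of P \<longrightarrow> edge_basis S v B \<longrightarrow> b \<in> B \<longrightarrow>
       R (dual_vector B b) (- of_int (int_pairing (dual_vector B b) v)))" (is "?L \<longleftrightarrow> ?R")
proof -
  have *: "R (ray_generator \<tau>) (facet_constant P \<tau>) \<longleftrightarrow> R (dual_vector B b) (- of_int (int_pairing (dual_vector B b) v))"
    if "real_vec v extreme_point_of P" "edge_basis S v B" "b \<in> B"
      and \<tau>: "\<tau> = {t *\<^sub>R real_vec (dual_vector B b) | t. t \<ge> 0}" for v B b \<tau>
    using ray_data_of_edge_basis[OF that(2,3)] that(1)
    unfolding \<tau> P_def by (simp add: extreme_point_of_def inner_real_vec)
  show ?thesis
  proof
    assume L: ?L
    show ?R
    proof (intro allI impI)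
      fix v B b assume vBb: "real_vec v extreme_point_of P" "edge_basis S v B" "b \<in> B"
      let ?\<tau> = "{t *\<^sub>R real_vec (dual_vector B b) | t. t \<ge> 0}"
      have "?\<tau> \<in> fan_rays (normal_fan P)" using vBb unfolding P_def fan_rays_iff[OF S] by blast
      then show "R (dual_vector B b) (- of_int (int_pairing (dual_vector B b) v))"
        using L *[OF vBb refl] by blast
    qed
  next
    assume R: ?R
    show ?L
    proof
      fix \<tau> assume "\<tau> \<in> fan_rays (normal_fan P)"
      then obtain v B b where vBb: "real_vec v extreme_point_of P" "edge_basis S v B" "b \<in> B"
        and \<tau>: "\<tau> = {t *\<^sub>R real_vec (dual_vector B b) | t. t \<ge> 0}"
        unfolding P_def fan_rays_iff[OF S] by blast
      show "R (ray_generator \<tau>) (facet_constant P \<tau>)"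
        using R *[OF vBb \<tau>] vBb by blast
    qed
  qed
qed

theorem theorem3p10:
  fixes p :: "'n::finite laurent"
  assumes "p \<noteq> 0" and "unimodular (supp p)"
  defines "rays \<equiv> fan_rays (normal_fan (newton_polytope p))"
    and "u \<equiv> \<lambda>\<tau>. real_vec (ray_generator \<tau>)"
    and "a \<equiv> facet_constant (newton_polytope p)"
  shows "(\<forall>\<tau>\<in>rays. a \<tau> \<in> \<int>) \<and>
    newton_polytope p = {x. \<forall>\<tau>\<in>rays. u \<tau> \<bullet> x \<ge> - a \<tau>} \<and>
    newton_polytope (mu p) = {x. \<forall>\<tau>\<in>rays. u \<tau> \<bullet> x \<ge> - (real CARD('n) + 1) * a \<tau> + 1}"
proof -
  let ?P = "newton_polytope p"
  define vertex where "vertex v \<longleftrightarrow> real_vec v extreme_point_of ?P" for v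
  have P: "?P = convex hull (real_vec ` supp p)" by (simp add: newton_polytope_def)
  note rays_iff = rays_iff_edge_bases[OF assms(2), folded P, folded rays_def vertex_def]
  have ne: "supp p \<noteq> {}" using assms(1) by simp
  have vertex_supp: "v \<in> supp p" if "vertex v" for v
    using vertex_in_support that unfolding vertex_def P .
  have B_ex: "\<exists>B. edge_basis (supp p) v B" if "vertex v" for v
    using edge_basis_exists[OF assms(2)] that unfolding vertex_def P .
  note hull = in_convex_hull_of_vertex_points[OF finite_supp ne, folded P, folded vertex_def]
  have "\<forall>\<tau>\<in>rays. a \<tau> \<in> \<int>"
    unfolding a_def rays_iff[of "\<lambda>_ a. a \<in> \<int>"] by simp
  moreover have "?P = {x. \<forall>\<tau>\<in>rays. u \<tau> \<bullet> x \<ge> - a \<tau>}"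
  proof -
    have eq: "(\<forall>\<tau>\<in>rays. u \<tau> \<bullet> x \<ge> - a \<tau>) \<longleftrightarrow> (\<forall>v B b. vertex v \<longrightarrow> edge_basis (supp p) v B \<longrightarrow> b \<in> B \<longrightarrow>
        real_vec (dual_vector B b) \<bullet> real_vec v \<le> real_vec (dual_vector B b) \<bullet> x)" for x
      unfolding a_def u_def rays_iff[of "\<lambda>u a. real_vec u \<bullet> x \<ge> - a"] by (simp add: inner_real_vec)
    show ?thesis
      unfolding eq
    proof (intro equalityI subsetI CollectI allI impI)
      fix x v B b assume "x \<in> ?P" "edge_basis (supp p) v B" "b \<in> B"
      then show "real_vec (dual_vector B b) \<bullet> real_vec v \<le> real_vec (dual_vector B b) \<bullet> x"
        by (auto simp: edge_basis_def P)
    next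
      fix x assume x: "x \<in> {x. \<forall>v B b. vertex v \<longrightarrow> edge_basis (supp p) v B \<longrightarrow> b \<in> B \<longrightarrow>
        real_vec (dual_vector B b) \<bullet> real_vec v \<le> real_vec (dual_vector B b) \<bullet> x}"
      have "x \<in> convex hull {real_vec v | v. vertex v}"
      proof (rule hull)
        fix v assume v: "vertex v"
        obtain B where "edge_basis (supp p) v B" using B_ex[OF v] by blast
        then show "\<exists>B. edge_basis (supp p) v B \<and>
            (\<forall>b\<in>B. real_vec (dual_vector B b) \<bullet> real_vec v \<le> real_vec (dual_vector B b) \<bullet> x)"
          using x v by auto
      qed
      also have "\<dots> \<subseteq> ?P" unfolding P using vertex_supp by (intro hull_mono) auto
      finally show "x \<in> ?P" .
    qed
  qed
  moreover have "newton_polytope (mu p) = {x. \<forall>\<tau>\<in>rays. u \<tau> \<bullet> x \<ge> - (real CARD('n) + 1) * a \<tau> + 1}"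
  proof -
    have eq: "(\<forall>\<tau>\<in>rays. u \<tau> \<bullet> x \<ge> - (real CARD('n) + 1) * a \<tau> + 1) \<longleftrightarrow>
      (\<forall>v B b. vertex v \<longrightarrow> edge_basis (supp p) v B \<longrightarrow> b \<in> B \<longrightarrow>
        real_of_int (int (Suc CARD('n)) * int_pairing (dual_vector B b) v + 1) \<le> real_vec (dual_vector B b) \<bullet> x)" for x
      unfolding a_def u_def rays_iff[of "\<lambda>u a. real_vec u \<bullet> x \<ge> - (real CARD('n) + 1) * a + 1"]
      by (simp add: algebra_simps)
    let ?Q = "{x. \<forall>v B b. vertex v \<longrightarrow> edge_basis (supp p) v B \<longrightarrow> b \<in> B \<longrightarrow>
        real_of_int (int (Suc CARD('n)) * int_pairing (dual_vector B b) v + 1) \<le> real_vec (dual_vector B b) \<bullet> x}"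
    show ?thesis
      unfolding eq
    proof
      have "real_vec k \<in> ?Q" if "k \<in> supp (mu p)" for k
        unfolding mem_Collect_eq inner_real_vec of_int_le_iff
        using supp_mu_pairing_ge[OF assms(1) _ vertex_supp _ that] by blast
      moreover have "convex ?Q"
        unfolding Collect_all_eq Collect_imp_eq
        by (intro convex_INT) (auto simp: convex_halfspace_ge)
      ultimately show "newton_polytope (mu p) \<subseteq> ?Q"
        unfolding newton_polytope_def by (intro hull_minimal) auto
    next
      \<comment> \<open>The inequalities at \<open>v\<close> are equalities at \<open>z v\<close>.\<close>
      obtain C where C: "\<And>v. vertex v \<Longrightarrow> edge_basis (supp p) v (C v)" using B_ex by metis
      define z where "z v = real_vec (int (Suc CARD('n)) *s v + \<Sum>(C v))" for v
      show "?Q \<subseteq> newton_polytope (mu p)"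
      proof
        fix x assume x: "x \<in> ?Q"
        have "x \<in> convex hull {z v | v. vertex v}"
        proof (rule hull)
          fix v assume v: "vertex v"
          interpret lattice_with_basis "C v" by unfold_locales (use C[OF v] edge_basis_def in blast)
          have "real_vec (dual_vector (C v) b) \<bullet> z v \<le> real_vec (dual_vector (C v) b) \<bullet> x" if b: "b \<in> C v" for b
          proof -
            have "int_pairing (dual_vector (C v) b) (\<Sum>(C v)) = (\<Sum>c\<in>C v. if c = b then 1 else 0)"
              unfolding int_pairing_sum using b
              by (intro sum.cong) (auto simp: int_pairing_dual_vector int_vec.representation_basis independent)
            then have "int_pairing (dual_vector (C v) b) (int (Suc CARD('n)) *s v + \<Sum>(C v)) =
                int (Suc CARD('n)) * int_pairing (dual_vector (C v) b) v + 1"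
              using b finite_basis by (simp add: int_pairing_add int_pairing_scale del: of_nat_Suc)
            then show ?thesis
              using x v C[OF v] b unfolding z_def inner_real_vec by auto
          qed
          then show "\<exists>B. edge_basis (supp p) v B \<and>
              (\<forall>b\<in>B. real_vec (dual_vector B b) \<bullet> z v \<le> real_vec (dual_vector B b) \<bullet> x)"
            using C[OF v] by blast
        qed
        also have "\<dots> \<subseteq> newton_polytope (mu p)"
          unfolding newton_polytope_def z_def
          using vertex_sum_in_supp_mu[OF assms(1) C vertex_supp] by (intro hull_mono) blast
        finally show "x \<in> newton_polytope (mu p)" .
      qed
    qed
  qed
  ultimately show ?thesis by blast
qed

end
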